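(* The substitution $u_i\mapsto 1/x$ induces a morphism of pre-Lie algebras $$\mathscr F:\ f\mapsto f(x^{-1},\dots,x^{-1})\,\partial_x$$ from the space of moulds $f=(f_n)_{n\ge1}$ such that each $f_n$ is homogeneous of weight $-n$, vegetal, and has nice poles, endowed with the pre-Lie product $\circ$, to the pre-Lie algebra of vector fields in the variable $x$ with formal power series in $x$ as coefficients. (For a mould $f=(f_n)_{n\ge1}$, $f(x^{-1},\dots,x^{-1})$ means $\sum_{n\ge1}f_n(x^{-1},\dots,x^{-1})$.)
   Context: Notation: $u_{i\dots j}=\sum_{i\le k\le j}u_k$. A mould is a sequence $(f_n)_{n\ge1}$ where $f_n$ is a rational function with rational coefficients in $u_1,\dots,u_n$; $\mathrm{Mould}(n)$ denotes the space of such functions $f_n$ (moulds of degree $n$). Homogeneous of weight $d$: homogeneous of degree $d$ when every $u_i$ has weight $1$. Nice poles: the only poles of the function are at linear forms $u_{i\dots j}$, $i\le j$, with arbitrary multiplicity. Vegetal: $f\in\mathrm{Mould}(n)$ is vegetal if $$u_1\cdots u_n\sum_{\sigma\in\mathfrak S_n}f(tu_{\sigma(1)},\dots,tu_{\sigma(n)})=n!\,f(t,\dots,t).$$ Pre-Lie product $\circ$ on moulds: for $f\in\mathrm{Mould}(m)$ and $g\in\mathrm{Mould}(n)$, $f\circ g\in\mathrm{Mould}(m+n-1)$ is $$f\circ g=\sum_{i=1}^{m}f(u_1,\dots,u_{i-1},u_{i\dots i+n-1},u_{i+n},\dots,u_{m+n-1})\,g(u_i,\dots,u_{i+n-1})\,u_{i\dots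 i+n-1},$$ extended bilinearly to moulds (finite sums in each degree). The subspace of moulds described in the claim is closed under $\circ$. A pre-Lie product on $V$ is a bilinear product $*$ with $(x*y)*z-x*(y*z)=(x*z)*y-x*(z*y)$. The pre-Lie product on vector fields is $F(x)\partial_x\circ G(x)\partial_x=(\partial_xF(x))\,G(x)\,\partial_x$. *)

theory Defs
  imports
    "HOL-Library.Poly_Mapping"
    "HOL-Library.Function_Algebras"
    "HOL-Computational_Algebra.Computational_Algebra"
    "HOL-Combinatorics.Permutations"
begin

section \<open>Rational functions in several variables\<close>

text \<open>
  Polynomials over the rationals in the variables numbered by the natural numbers: a monomial is a
  finitely supported exponent function, a polynomial a finitely supported coefficient function on
  monomials.  Rational functions form the fraction field.  The variables \<open>u\<^sub>1, u\<^sub>2, \<dots>\<close> of moulds have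
  the numbers \<open>1, 2, \<dots>\<close>; number \<open>0\<close> is kept for the auxiliary variable \<open>t\<close> in the definition of
  vegetal functions.
\<close>

type_synonym mpoly = "(nat \<Rightarrow>\<^sub>0 nat) \<Rightarrow>\<^sub>0 rat"
type_synonym ratfun = "mpoly fract"

instance fract :: ("{idom, ring_char_0}") field_char_0
proof
  show "inj (of_nat :: nat \<Rightarrow> 'a fract)"
    by (rule injI) (simp add: Fract_of_nat_eq [symmetric] eq_fract)
qed

definition pvar :: "nat \<Rightarrow> mpoly"
  where "pvar i = Poly_Mapping.single (Poly_Mapping.single i 1) 1"

definition pvars :: "mpoly \<Rightarrow> nat set"
  where "pvars P = (\<Union>m\<in>Poly_Mapping.keys P. Poly_Mapping.keys m)"

definition phom :: "nat \<Rightarrow> mpoly \<Rightarrow> bool"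
  where "phom d P \<longleftrightarrow>
    (\<forall>m\<in>Poly_Mapping.keys P. (\<Sum>i\<in>Poly_Mapping.keys m. Poly_Mapping.lookup m i) = d)"

definition peval :: "(nat \<Rightarrow> 'k::field_char_0) \<Rightarrow> mpoly \<Rightarrow> 'k"
  where "peval a P =
    (\<Sum>m\<in>Poly_Mapping.keys P. of_rat (Poly_Mapping.lookup P m) *
       (\<Prod>i\<in>Poly_Mapping.keys m. a i ^ Poly_Mapping.lookup m i))"

text \<open>
  Substitution of elements \<open>a i\<close> of a field for the variables.  It is defined when some fraction
  representing the function has a denominator that does not vanish at \<open>a\<close>; the value does not depend
  on that fraction.  Outside this case the value is the dummy \<open>0\<close>.
\<close>

definition rsubst_defined :: "(nat \<Rightarrow> 'k::field_char_0) \<Rightarrow> ratfun \<Rightarrow> bool"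
  where "rsubst_defined a f \<longleftrightarrow> (\<exists>P Q. f = Fract P Q \<and> peval a Q \<noteq> 0)"

definition rsubst :: "(nat \<Rightarrow> 'k::field_char_0) \<Rightarrow> ratfun \<Rightarrow> 'k"
  where "rsubst a f =
    (if rsubst_defined a f
     then (THE y. \<exists>P Q. f = Fract P Q \<and> peval a Q \<noteq> 0 \<and> y = peval a P / peval a Q)
     else 0)"

definition uvar :: "nat \<Rightarrow> ratfun"
  where "uvar i = Fract (pvar i) 1"

text \<open>The linear form \<open>u\<^sub>i + \<dots> + u\<^sub>j\<close>, as a polynomial and as a rational function.\<close>

definition pusum :: "nat \<Rightarrow> nat \<Rightarrow> mpoly"
  where "pusum i j = (\<Sum>k\<in>{i..j}. pvar k)"

definition usum :: "nat \<Rightarrow> nat \<Rightarrow> ratfun"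
  where "usum i j = Fract (pusum i j) 1"


section \<open>Moulds\<close>

definition Mould :: "nat \<Rightarrow> ratfun set"
  where "Mould n =
    {Fract P Q | P Q. Q \<noteq> 0 \<and> pvars P \<subseteq> {1..n} \<and> pvars Q \<subseteq> {1..n}}"

text \<open>The zero function is homogeneous of every weight.\<close>

definition homogeneous :: "int \<Rightarrow> ratfun \<Rightarrow> bool"
  where "homogeneous d f \<longleftrightarrow>
    (\<exists>P Q a b. Q \<noteq> 0 \<and> f = Fract P Q \<and> phom a P \<and> phom b Q \<and> int a - int b = d)"

text \<open>
  \<open>pole f p\<close>: \<open>f\<close> has a pole (of some order) along the irreducible hypersurface \<open>p = 0\<close>, i.e. \<open>p\<close>
  is an irreducible factor of the denominator of \<open>f\<close> written in lowest terms.  Lowest terms is spelled out, because \<open>coprime\<close>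
  is only available for types with a division operation.
\<close>

definition pole :: "ratfun \<Rightarrow> mpoly \<Rightarrow> bool"
  where "pole f p \<longleftrightarrow> irreducible p \<and>
    (\<exists>P Q. Q \<noteq> 0 \<and> f = Fract P Q \<and>
       (\<forall>c. c dvd P \<longrightarrow> c dvd Q \<longrightarrow> c dvd 1) \<and> p dvd Q)"

text \<open>Mutual divisibility means equality up to a nonzero rational factor.\<close>

definition nice_poles :: "nat \<Rightarrow> ratfun \<Rightarrow> bool"
  where "nice_poles n f \<longleftrightarrow>
    (\<forall>p. pole f p \<longrightarrow>
       (\<exists>i j. 1 \<le> i \<and> i \<le> j \<and> j \<le> n \<and> p dvd pusum i j \<and> pusum i j dvd p))"

definition vegetal :: "nat \<Rightarrow> ratfun \<Rightarrow> bool"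
  where "vegetal n f \<longleftrightarrow>
    (let t = uvar 0 in
       rsubst_defined (\<lambda>_. t) f \<and>
       (\<Prod>i\<in>{1..n}. uvar i) * (\<Sum>\<sigma> | \<sigma> permutes {1..n}. rsubst (\<lambda>i. t * uvar (\<sigma> i)) f) =
         fact n * rsubst (\<lambda>_. t) f)"

text \<open>
  A mould is a sequence indexed by \<open>n \<ge> 1\<close>; the entry at index \<open>0\<close> is a dummy, fixed to be \<open>0\<close>.
  Addition of moulds is the pointwise addition of functions.
\<close>

definition moulds :: "(nat \<Rightarrow> ratfun) set"
  where "moulds = {f. f 0 = 0 \<and> (\<forall>n\<ge>1. f n \<in> Mould n)}"

definition mould_scale :: "rat \<Rightarrow> (nat \<Rightarrow> ratfun) \<Rightarrow> (nat \<Rightarrow> ratfun)"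
  where "mould_scale c f = (\<lambda>n. of_rat c * f n)"

definition vegetal_moulds :: "(nat \<Rightarrow> ratfun) set"
  where "vegetal_moulds =
    {f \<in> moulds. \<forall>n\<ge>1. homogeneous (- int n) (f n) \<and> vegetal n (f n) \<and> nice_poles n (f n)}"

text \<open>The product of \<open>f \<in> Mould m\<close> and \<open>g \<in> Mould n\<close>, for \<open>m, n \<ge> 1\<close>.\<close>

definition circ :: "nat \<Rightarrow> nat \<Rightarrow> ratfun \<Rightarrow> ratfun \<Rightarrow> ratfun"
  where "circ m n f g =
    (\<Sum>i\<in>{1..m}.
       rsubst (\<lambda>k. if k < i then uvar k
                  else if k = i then usum i (i + n - 1)
                  else uvar (k + n - 1)) f *
       rsubst (\<lambda>k. uvar (i + k - 1)) g *
       usum i (i + n - 1))"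

text \<open>The degree \<open>N\<close> part collects the products of degrees \<open>m, n \<ge> 1\<close> with \<open>m + n - 1 = N\<close>.\<close>

definition mould_circ :: "(nat \<Rightarrow> ratfun) \<Rightarrow> (nat \<Rightarrow> ratfun) \<Rightarrow> (nat \<Rightarrow> ratfun)"
  where "mould_circ f g =
    (\<lambda>N. \<Sum>m\<in>{1..N}. circ m (N + 1 - m) (f m) (g (N + 1 - m)))"


section \<open>Pre-Lie algebras and their morphisms\<close>

locale pre_lie_algebra = vector_space scale
  for scale :: "'k::field \<Rightarrow> 'v::ab_group_add \<Rightarrow> 'v" +
  fixes V :: "'v set" and pl :: "'v \<Rightarrow> 'v \<Rightarrow> 'v"
  assumes carrier_subspace: "subspace V"
    and pl_closed: "x \<in> V \<Longrightarrow> y \<in> V \<Longrightarrow> pl x y \<in> V"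
    and pl_add_left: "x \<in> V \<Longrightarrow> y \<in> V \<Longrightarrow> z \<in> V \<Longrightarrow> pl (x + y) z = pl x z + pl y z"
    and pl_add_right: "x \<in> V \<Longrightarrow> y \<in> V \<Longrightarrow> z \<in> V \<Longrightarrow> pl x (y + z) = pl x y + pl x z"
    and pl_scale_left: "x \<in> V \<Longrightarrow> y \<in> V \<Longrightarrow> pl (scale c x) y = scale c (pl x y)"
    and pl_scale_right: "x \<in> V \<Longrightarrow> y \<in> V \<Longrightarrow> pl x (scale c y) = scale c (pl x y)"
    and pre_lie: "x \<in> V \<Longrightarrow> y \<in> V \<Longrightarrow> z \<in> V \<Longrightarrow>
      pl (pl x y) z - pl x (pl y z) = pl (pl x z) y - pl x (pl z y)"

locale pre_lie_morphism =
  src: pre_lie_algebra s1 V1 pl1 + tgt: pre_lie_algebra s2 V2 pl2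
  for s1 :: "'k::field \<Rightarrow> 'v::ab_group_add \<Rightarrow> 'v" and V1 pl1
    and s2 :: "'k \<Rightarrow> 'w::ab_group_add \<Rightarrow> 'w" and V2 pl2 +
  fixes \<phi> :: "'v \<Rightarrow> 'w"
  assumes morphism_closed: "x \<in> V1 \<Longrightarrow> \<phi> x \<in> V2"
    and morphism_add: "x \<in> V1 \<Longrightarrow> y \<in> V1 \<Longrightarrow> \<phi> (x + y) = \<phi> x + \<phi> y"
    and morphism_scale: "x \<in> V1 \<Longrightarrow> \<phi> (s1 c x) = s2 c (\<phi> x)"
    and morphism_pl: "x \<in> V1 \<Longrightarrow> y \<in> V1 \<Longrightarrow> \<phi> (pl1 x y) = pl2 (\<phi> x) (\<phi> y)"


section \<open>Vector fields and the map from moulds to vector fields\<close>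

text \<open>The vector field \<open>F(x) \<partial>\<^sub>x\<close> is represented by its coefficient \<open>F\<close>.\<close>

type_synonym vector_field = "rat fps"

definition vf_scale :: "rat \<Rightarrow> vector_field \<Rightarrow> vector_field"
  where "vf_scale c F = fps_const c * F"

definition vf_circ :: "vector_field \<Rightarrow> vector_field \<Rightarrow> vector_field"
  where "vf_circ F G = fps_deriv F * G"

text \<open>The substitution \<open>u\<^sub>i \<mapsto> 1/x\<close>, carried out in the field of formal Laurent series in \<open>x\<close>.\<close>

definition at_x_inv :: "ratfun \<Rightarrow> rat fls"
  where "at_x_inv f = rsubst (\<lambda>_. inverse fls_X) f"

text \<open>
  The sum over \<open>n \<ge> 1\<close> is taken in the \<open>x\<close>-adic topology of Laurent series and then read as a power
  series; this loses nothing when the sum converges to a series without negative powers of \<open>x\<close>.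
\<close>

definition mould_to_vf :: "(nat \<Rightarrow> ratfun) \<Rightarrow> vector_field"
  where "mould_to_vf f = fls_regpart (suminf (\<lambda>n. at_x_inv (f (Suc n))))"

end

theory Submission
  imports Defs
begin

text \<open>
  A function with nice poles is a fraction whose denominator is a product of linear forms
  \<open>u\<^sub>i + \<dots> + u\<^sub>j\<close>, so it can be evaluated at every sequence \<open>a\<close> of elements of a field of
  characteristic \<open>0\<close> whose sums over intervals do not vanish (\<open>admissible\<close>).  Replacing a block of
  consecutive entries of such a sequence by its sum (\<open>blk\<close>), or restricting to the block
  (\<open>seg\<close>), gives again such a sequence.  Therefore the product \<open>f \<circ> g\<close> can be evaluated
  termwise, and everything about it becomes a statement on functions of sequences.

  The three conditions on a mould are used in the form of \<open>nice_homogeneous_iff\<close>: in degree \<open>n\<close>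
  they describe the fractions with a homogeneous numerator in \<open>u\<^sub>1, \<dots>, u\<^sub>n\<close> and a product of linear
  forms as denominator.  One direction needs fractions in lowest terms, which have a denominator of
  minimal total degree; the other needs only that the linear forms are prime, which holds because each of
  them eliminates a variable (\<open>pusum_prime\<close>).  Unique factorization is not used.

  The pre-Lie identity holds because \<open>(f \<circ> g) \<circ> h - f \<circ> (g \<circ> h)\<close> collects the terms in which
  \<open>g\<close> and \<open>h\<close> are inserted into two different slots of \<open>f\<close>, and these are symmetric in \<open>g\<close> and \<open>h\<close>
  (\<open>circ_fun_circ_fun\<close>).

  The product of vegetal functions \<open>f\<close>, \<open>g\<close> of degrees \<open>m\<close>, \<open>n\<close> is vegetal (\<open>vegetal_fun_circ_fun\<close>):
  in the sum over all permutations of \<open>m + n - 1\<close> variables, summing first over the permutations of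
  the \<open>m\<close> slots of \<open>f\<close>, one of them filled by the block, replaces \<open>f\<close> by its value at a constant sequence,
  divided by the product of the entries; the factor \<open>u\<^sub>i + \<dots> + u\<^sub>j\<close> of the block cancels.
  Then the sum over the permutations inside the block does the same to \<open>g\<close>.  What remains is
  \<open>m t f(t,\<dots>,t) g(t,\<dots>,t)\<close>, up to a factorial and the product of the variables.  At equal variables
  this says \<open>(f \<circ> g)(1,\<dots>,1) = m f(1,\<dots>,1) g(1,\<dots>,1)\<close> (\<open>rsubst_const_circ\<close>).  By homogeneity the
  substitution \<open>u\<^sub>i \<mapsto> 1/x\<close> sends \<open>f\<close> to \<open>f(1,\<dots>,1) x\<^sup>m\<close>, and
  \<open>x\<^sup>m \<mapsto> m x\<^bsup>m-1\<^esup>\<close> is the derivative in the product of vector fields.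
\<close>

section \<open>Evaluation of polynomials in several variables\<close>

text \<open>
  A ring homomorphism from the rational numbers, used to map coefficients into the target ring of an
  evaluation.  The targets are fields, the polynomials themselves, and polynomials over them.
\<close>

locale coeff_hom =
  fixes \<phi> :: "rat \<Rightarrow> 'a::comm_ring_1"
  assumes hom_add: "\<phi> (c + d) = \<phi> c + \<phi> d"
    and hom_mult: "\<phi> (c * d) = \<phi> c * \<phi> d"
    and hom_1: "\<phi> 1 = 1"
begin

lemma hom_0: "\<phi> 0 = 0"
  using hom_add [of 0 0] by simp

end

text \<open>
  The value \<open>monev a m\<close> of a monomial and the value \<open>mev \<phi> a P\<close> of a polynomial at a sequence \<open>a\<close>,
  for coefficients mapped by \<open>\<phi>\<close>.
\<close>

definition monev :: "(nat \<Rightarrow> 'a::comm_monoid_mult) \<Rightarrow> (nat \<Rightarrow>\<^sub>0 nat) \<Rightarrow> 'a"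
  where "monev a m = (\<Prod>i\<in>Poly_Mapping.keys m. a i ^ Poly_Mapping.lookup m i)"

definition mev :: "(rat \<Rightarrow> 'a::comm_ring_1) \<Rightarrow> (nat \<Rightarrow> 'a) \<Rightarrow> mpoly \<Rightarrow> 'a"
  where "mev \<phi> a P = (\<Sum>m\<in>Poly_Mapping.keys P. \<phi> (Poly_Mapping.lookup P m) * monev a m)"

lemma peval_eq_mev: "peval a = mev of_rat a"
  by (simp add: fun_eq_iff peval_def mev_def monev_def)

lemma monev_superset:
  assumes "finite A" "Poly_Mapping.keys m \<subseteq> A"
  shows "monev a m = (\<Prod>i\<in>A. a i ^ Poly_Mapping.lookup m i)"
  unfolding monev_def
  by (rule prod.mono_neutral_left) (use assms in \<open>auto simp: in_keys_iff\<close>)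

lemma monev_add: "monev a (m + m') = monev a m * monev a m'"
proof -
  let ?A = "Poly_Mapping.keys m \<union> Poly_Mapping.keys m'"
  have "monev a (m + m') = (\<Prod>i\<in>?A. a i ^ Poly_Mapping.lookup (m + m') i)"
    by (rule monev_superset) (use Poly_Mapping.keys_add [of m m'] in auto)
  also have "\<dots> = monev a m * monev a m'"
    by (simp add: lookup_add power_add prod.distrib monev_superset [of ?A])
  finally show ?thesis .
qed

lemma monev_0 [simp]: "monev a 0 = 1"
  by (simp add: monev_def)

lemma monev_single [simp]: "monev a (Poly_Mapping.single i k) = a i ^ k"
  by (cases "k = 0") (simp_all add: monev_def)

lemma monev_cong: "(\<And>i. i \<in> Poly_Mapping.keys m \<Longrightarrow> a i = b i) \<Longrightarrow> monev a m = monev b m"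
  by (simp add: monev_def)

lemma poly_mapping_eq_sum_single:
  "P = (\<Sum>m\<in>Poly_Mapping.keys P. Poly_Mapping.single m (Poly_Mapping.lookup P m))"
  by (rule poly_mapping_eqI)
    (auto simp: lookup_sum lookup_single when_def in_keys_iff)

lemma poly_mapping_single_induct [case_names zero add_single]:
  fixes P :: "'b \<Rightarrow>\<^sub>0 'c::comm_monoid_add"
  assumes "R 0" "\<And>P m c. R P \<Longrightarrow> R (P + Poly_Mapping.single m c)"
  shows "R P"
proof -
  have "R (\<Sum>m\<in>A. Poly_Mapping.single m (Poly_Mapping.lookup P m))" if "finite A" for A
    using that by induction (simp_all add: assms add.commute [of "Poly_Mapping.single _ _"])
  from this [of "Poly_Mapping.keys P"] show ?thesis
    by (simp flip: poly_mapping_eq_sum_single)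
qed

context coeff_hom
begin

lemma mev_superset:
  assumes "finite A" "Poly_Mapping.keys P \<subseteq> A"
  shows "mev \<phi> a P = (\<Sum>m\<in>A. \<phi> (Poly_Mapping.lookup P m) * monev a m)"
  unfolding mev_def
  by (rule sum.mono_neutral_left) (use assms in \<open>auto simp: in_keys_iff hom_0\<close>)

lemma mev_0 [simp]: "mev \<phi> a 0 = 0"
  by (simp add: mev_def)

lemma mev_add: "mev \<phi> a (P + Q) = mev \<phi> a P + mev \<phi> a Q"
proof -
  let ?A = "Poly_Mapping.keys P \<union> Poly_Mapping.keys Q"
  have "mev \<phi> a (P + Q) = (\<Sum>m\<in>?A. \<phi> (Poly_Mapping.lookup (P + Q) m) * monev a m)"
    by (rule mev_superset) (use Poly_Mapping.keys_add [of P Q] in auto)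
  also have "\<dots> = mev \<phi> a P + mev \<phi> a Q"
    by (simp add: lookup_add hom_add distrib_right sum.distrib mev_superset [of ?A])
  finally show ?thesis .
qed

lemma mev_single: "mev \<phi> a (Poly_Mapping.single m c) = \<phi> c * monev a m"
  by (cases "c = 0") (simp_all add: mev_def hom_0)

lemma mev_1 [simp]: "mev \<phi> a 1 = 1"
  using mev_single [of a 0 1] by (simp add: hom_1)

lemma mev_mult: "mev \<phi> a (P * Q) = mev \<phi> a P * mev \<phi> a Q"
proof (induction P rule: poly_mapping_single_induct)
  case (add_single P m c)
  have "mev \<phi> a (Poly_Mapping.single m c * Q) = mev \<phi> a (Poly_Mapping.single m c) * mev \<phi> a Q"
    by (induction Q rule: poly_mapping_single_induct)
      (simp_all add: distrib_left mev_add mult_single mev_single hom_mult monev_add mult_ac)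
  with add_single show ?case
    by (simp add: distrib_right mev_add)
qed simp

lemma mev_pvar [simp]: "mev \<phi> a (pvar i) = a i"
  by (simp add: pvar_def mev_single hom_1)

lemma mev_sum: "mev \<phi> a (\<Sum>i\<in>A. f i) = (\<Sum>i\<in>A. mev \<phi> a (f i))"
  by (induction A rule: infinite_finite_induct) (simp_all add: mev_add)

lemma mev_pusum: "mev \<phi> a (pusum i j) = (\<Sum>k\<in>{i..j}. a k)"
  by (simp add: pusum_def mev_sum)

end

lemma mev_cong:
  assumes "\<And>i. i \<in> pvars P \<Longrightarrow> a i = b i"
  shows "mev \<phi> a P = mev \<phi> b P"
  unfolding mev_def
  by (intro sum.cong refl arg_cong2 [where f = "(*)"] monev_cong)
    (use assms in \<open>auto simp: pvars_def\<close>)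

text \<open>A ring homomorphism commutes with evaluation.\<close>

lemma hom_mev:
  assumes "\<And>x y. h (x + y) = h x + h y" "\<And>x y. h (x * y) = h x * h y" "h 0 = 0" "h 1 = 1"
  shows "h (mev \<phi> a P) = mev (h \<circ> \<phi>) (h \<circ> a) P"
proof -
  have s: "h (sum f A) = (\<Sum>i\<in>A. h (f i))" if "finite A" for f and A :: "'d set"
    using that by induction (simp_all add: assms)
  have p: "h (prod f A) = (\<Prod>i\<in>A. h (f i))" if "finite A" for f and A :: "'d set"
    using that by induction (simp_all add: assms)
  have pw: "h (x ^ k) = h x ^ k" for x k
    by (induction k) (simp_all add: assms)
  show ?thesis
    by (simp add: mev_def monev_def s p pw assms)
qed

interpretation of_rat_hom: coeff_hom "of_rat :: rat \<Rightarrow> 'a::field_char_0"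
  by standard (simp_all add: of_rat_add of_rat_mult)

section \<open>Variables and homogeneous components\<close>

text \<open>
  The constant polynomial; evaluation with these coefficients is substitution of polynomials.
\<close>

definition pconst :: "rat \<Rightarrow> mpoly"
  where "pconst c = Poly_Mapping.single 0 c"

interpretation pconst_hom: coeff_hom pconst
  by standard (simp_all add: pconst_def single_add mult_single)

lemma monev_pvar: "monev pvar m = Poly_Mapping.single m 1"
proof (induction m rule: poly_mapping_single_induct)
  case (add_single m i k)
  have "pvar i ^ k = Poly_Mapping.single (Poly_Mapping.single i k) 1"
    by (induction k) (simp_all add: pvar_def mult_single flip: single_add)
  with add_single show ?case
    by (simp add: monev_add mult_single)
qed simp

lemma mev_pconst_pvar: "mev pconst pvar P = P"
proof -
  have "mev pconst pvar P = (\<Sum>m\<in>Poly_Mapping.keys P. Poly_Mapping.single m (Poly_Mapping.lookup P m))"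
    by (simp add: mev_def monev_pvar pconst_def mult_single)
  then show ?thesis
    by (simp flip: poly_mapping_eq_sum_single)
qed

lemma pvars_0 [simp]: "pvars 0 = {}"
  by (simp add: pvars_def)

lemma pvars_1 [simp]: "pvars 1 = {}"
  by (simp add: pvars_def)

lemma pvars_pconst [simp]: "pvars (pconst c) = {}"
  by (cases "c = 0") (simp_all add: pvars_def pconst_def)

lemma pvars_pvar [simp]: "pvars (pvar i) = {i}"
  by (simp add: pvars_def pvar_def)

lemma pvars_add: "pvars (P + Q) \<subseteq> pvars P \<union> pvars Q"
  using Poly_Mapping.keys_add [of P Q] unfolding pvars_def by blast

lemma pvars_mult: "pvars (P * Q) \<subseteq> pvars P \<union> pvars Q"
proof
  fix i assume "i \<in> pvars (P * Q)"
  then obtain m where m: "m \<in> Poly_Mapping.keys (P * Q)" "i \<in> Poly_Mapping.keys m"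
    by (auto simp: pvars_def)
  from m(1) obtain a b where ab: "m = a + b" "a \<in> Poly_Mapping.keys P" "b \<in> Poly_Mapping.keys Q"
    using keys_mult [of P Q] by blast
  then have "i \<in> Poly_Mapping.keys a \<union> Poly_Mapping.keys b"
    using m(2) Poly_Mapping.keys_add [of a b] by blast
  with ab show "i \<in> pvars P \<union> pvars Q"
    unfolding pvars_def by blast
qed

lemma pvars_sum: "(\<And>i. i \<in> A \<Longrightarrow> pvars (f i) \<subseteq> S) \<Longrightarrow> pvars (\<Sum>i\<in>A. f i) \<subseteq> S"
proof (induction A rule: infinite_finite_induct)
  case (insert x F)
  then show ?case using pvars_add [of "f x" "sum f F"] by fastforce
qed simp_all

lemma pvars_prod: "(\<And>i. i \<in> A \<Longrightarrow> pvars (f i) \<subseteq> S) \<Longrightarrow> pvars (\<Prod>i\<in>A. f i) \<subseteq> S"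
proof (induction A rule: infinite_finite_induct)
  case (insert x F)
  then show ?case using pvars_mult [of "f x" "prod f F"] by fastforce
qed simp_all

lemma pvars_power: "pvars (P ^ k) \<subseteq> pvars P"
proof (induction k)
  case (Suc k)
  then show ?case using pvars_mult [of P "P ^ k"] by auto
qed simp

lemma pvars_pusum: "pvars (pusum i j) \<subseteq> {i..j}"
  unfolding pusum_def by (rule pvars_sum) auto

lemma pvars_mev_pconst:
  assumes "\<And>i. i \<in> pvars P \<Longrightarrow> pvars (a i) \<subseteq> S"
  shows "pvars (mev pconst a P) \<subseteq> S"
  unfolding mev_def monev_def
proof (rule pvars_sum)
  fix m assume m: "m \<in> Poly_Mapping.keys P"
  have "pvars (\<Prod>i\<in>Poly_Mapping.keys m. a i ^ Poly_Mapping.lookup m i) \<subseteq> S"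
    by (rule pvars_prod) (use m assms pvars_power in \<open>fastforce simp: pvars_def\<close>)
  then show "pvars (pconst (Poly_Mapping.lookup P m) *
      (\<Prod>i\<in>Poly_Mapping.keys m. a i ^ Poly_Mapping.lookup m i)) \<subseteq> S"
    using pvars_mult by fastforce
qed

text \<open>The polynomial \<open>P(t u\<^sub>0, t u\<^sub>1, \<dots>)\<close> in \<open>t\<close> collects the homogeneous components of \<open>P\<close>.\<close>

definition hparts :: "mpoly \<Rightarrow> mpoly poly"
  where "hparts P = mev (\<lambda>c. [:pconst c:]) (\<lambda>i. [:0, pvar i:]) P"

interpretation hparts_hom: coeff_hom "\<lambda>c. [:pconst c:]"
  by standard (simp_all add: pconst_hom.hom_add pconst_hom.hom_mult pconst_hom.hom_1 one_pCons)

lemma hparts_mult: "hparts (P * Q) = hparts P * hparts Q"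
  by (simp add: hparts_def hparts_hom.mev_mult)

lemma poly_hparts: "poly (hparts P) x = mev pconst (\<lambda>i. x * pvar i) P"
  unfolding hparts_def
  by (subst hom_mev [where h = "\<lambda>p. poly p x"]) (simp_all add: comp_def)

lemma poly_hparts_1: "poly (hparts P) 1 = P"
  by (simp add: poly_hparts mev_pconst_pvar)

text \<open>
  The total degree of a monomial.
\<close>

definition mweight :: "(nat \<Rightarrow>\<^sub>0 nat) \<Rightarrow> nat"
  where "mweight m = (\<Sum>i\<in>Poly_Mapping.keys m. Poly_Mapping.lookup m i)"

lemma hparts_eq:
  "hparts P = (\<Sum>m\<in>Poly_Mapping.keys P. monom (Poly_Mapping.single m (Poly_Mapping.lookup P m)) (mweight m))"
proof -
  have *: "[:0, p:] ^ k = monom (p ^ k) k" for p :: mpoly and k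
    using monom_power [of p 1 k] by (simp add: monom_altdef)
  have "(\<Prod>i\<in>A. monom (f i) (g i)) = monom (prod f A) (sum g A)" if "finite A"
    for f :: "nat \<Rightarrow> mpoly" and g and A
    using that by induction (simp_all add: mult_monom)
  then have "monev (\<lambda>i. [:0, pvar i:]) m = monom (monev pvar m) (mweight m)" for m
    by (simp add: monev_def mweight_def *)
  then show ?thesis
    by (simp add: hparts_def mev_def monev_pvar smult_monom pconst_def mult_single)
qed

lemma phom_iff_coeff: "phom d P \<longleftrightarrow> (\<forall>k. k \<noteq> d \<longrightarrow> coeff (hparts P) k = 0)"
proof -
  have c: "Poly_Mapping.lookup (coeff (hparts P) k) m = (if mweight m = k then Poly_Mapping.lookup P m else 0)" for k m
  proof -
    have "Poly_Mapping.lookup (coeff (hparts P) k) m =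
        (\<Sum>x\<in>Poly_Mapping.keys P. if x = m then if mweight m = k then Poly_Mapping.lookup P m else 0 else 0)"
      unfolding hparts_eq coeff_sum lookup_sum
      by (rule sum.cong) (auto simp: lookup_single when_def)
    also have "\<dots> = (if mweight m = k then Poly_Mapping.lookup P m else 0)"
      using not_in_keys_iff_lookup_eq_zero [of m P] by simp
    finally show ?thesis .
  qed
  have "phom d P \<longleftrightarrow> (\<forall>m. Poly_Mapping.lookup P m \<noteq> 0 \<longrightarrow> mweight m = d)"
    by (simp add: phom_def mweight_def Ball_def flip: lookup_not_eq_zero_eq_in_keys)
  also have "\<dots> \<longleftrightarrow> (\<forall>k. k \<noteq> d \<longrightarrow> (\<forall>m. Poly_Mapping.lookup (coeff (hparts P) k) m = 0))"
    unfolding c by auto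
  also have "\<dots> \<longleftrightarrow> (\<forall>k. k \<noteq> d \<longrightarrow> coeff (hparts P) k = 0)"
    by (metis lookup_zero poly_mapping_eqI)
  finally show ?thesis .
qed

lemma phom_iff: "phom d P \<longleftrightarrow> hparts P = monom P d"
proof
  assume "phom d P"
  then have "hparts P = monom (coeff (hparts P) d) d"
    by (intro poly_eqI) (auto simp: phom_iff_coeff)
  moreover have "coeff (hparts P) d = P"
    using poly_hparts_1 [of P] by (subst (asm) calculation) (simp add: poly_monom)
  ultimately show "hparts P = monom P d" by simp
next
  assume "hparts P = monom P d"
  then show "phom d P" by (simp add: phom_iff_coeff)
qed

lemma phom_0: "phom d 0"
  by (simp add: phom_def)

lemma phom_pvar: "phom 1 (pvar i)"
  by (simp add: phom_def pvar_def)

lemma phom_pconst: "phom 0 (pconst c)"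
  by (cases "c = 0") (simp_all add: phom_def pconst_def)

lemma phom_1: "phom 0 1"
  using phom_pconst [of 1] by (simp add: pconst_hom.hom_1)

lemma phom_add: "phom d P \<Longrightarrow> phom d Q \<Longrightarrow> phom d (P + Q)"
  by (simp add: phom_iff_coeff hparts_def hparts_hom.mev_add)

lemma phom_mult: "phom d P \<Longrightarrow> phom e Q \<Longrightarrow> phom (d + e) (P * Q)"
  by (simp add: phom_iff hparts_mult mult_monom)

lemma phom_sum: "(\<And>i. i \<in> A \<Longrightarrow> phom d (f i)) \<Longrightarrow> phom d (\<Sum>i\<in>A. f i)"
  by (induction A rule: infinite_finite_induct) (auto simp: phom_0 phom_add)

lemma phom_pusum: "phom 1 (pusum i j)"
  unfolding pusum_def by (rule phom_sum) (rule phom_pvar)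

text \<open>
  If a nonzero product and one of its factors are homogeneous, so is the other factor: multiplication by
  \<open>hparts Q = Q t\<^sup>e\<close> only shifts and scales the components of \<open>P\<close>.
\<close>

lemma phom_factor:
  assumes "phom d (P * Q)" "phom e Q" "Q \<noteq> 0" "P \<noteq> 0"
  shows "e \<le> d" "phom (d - e) P"
proof -
  have eq: "hparts P * monom Q e = monom (P * Q) d"
    using assms by (simp add: phom_iff hparts_mult)
  have c: "coeff (hparts P) k * Q = (if k + e = d then P * Q else 0)" for k
  proof -
    have "coeff (hparts P) k * Q = coeff (monom Q e * hparts P) (k + e)"
      by (simp add: coeff_monom_mult mult.commute [of Q])
    also have "\<dots> = coeff (monom (P * Q) d) (k + e)"
      by (simp only: eq mult.commute [of "monom Q e"])
    finally show ?thesis by auto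
  qed
  show "e \<le> d"
  proof (rule ccontr)
    assume "\<not> e \<le> d"
    then have "hparts P = 0" using c \<open>Q \<noteq> 0\<close> by (intro poly_eqI) auto
    then show False using poly_hparts_1 [of P] \<open>P \<noteq> 0\<close> by simp
  qed
  then show "phom (d - e) P"
    unfolding phom_iff_coeff using c \<open>Q \<noteq> 0\<close> by (metis le_add_diff_inverse2 add_diff_cancel_right' mult_eq_0_iff)
qed

section \<open>Substitution into rational functions\<close>

lemma peval_0 [simp]: "peval a 0 = 0"
  by (simp add: peval_eq_mev)

lemma peval_1 [simp]: "peval a 1 = 1"
  by (simp add: peval_eq_mev)

lemma peval_add: "peval a (P + Q) = peval a P + peval a Q"
  by (simp add: peval_eq_mev of_rat_hom.mev_add)

lemma peval_mult: "peval a (P * Q) = peval a P * peval a Q"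
  by (simp add: peval_eq_mev of_rat_hom.mev_mult)

lemma peval_pvar [simp]: "peval a (pvar i) = a i"
  by (simp add: peval_eq_mev)

lemma peval_pusum: "peval a (pusum i j) = (\<Sum>k\<in>{i..j}. a k)"
  by (simp add: peval_eq_mev of_rat_hom.mev_pusum)

lemma peval_cong: "(\<And>i. i \<in> pvars P \<Longrightarrow> a i = b i) \<Longrightarrow> peval a P = peval b P"
  unfolding peval_eq_mev by (rule mev_cong)

lemma peval_pconst [simp]: "peval a (pconst c) = of_rat c"
  by (simp add: peval_eq_mev pconst_def of_rat_hom.mev_single)

lemma rsubst_Fract:
  assumes "peval a Q \<noteq> 0"
  shows "rsubst_defined a (Fract P Q)" "rsubst a (Fract P Q) = peval a P / peval a Q"
proof -
  show d: "rsubst_defined a (Fract P Q)"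
    using assms by (auto simp: rsubst_defined_def)
  have "(THE y. \<exists>P' Q'. Fract P Q = Fract P' Q' \<and> peval a Q' \<noteq> 0 \<and> y = peval a P' / peval a Q')
      = peval a P / peval a Q"
  proof (rule the_equality)
    show "\<exists>P' Q'. Fract P Q = Fract P' Q' \<and> peval a Q' \<noteq> 0 \<and>
        peval a P / peval a Q = peval a P' / peval a Q'"
      using assms by blast
  next
    fix y assume "\<exists>P' Q'. Fract P Q = Fract P' Q' \<and> peval a Q' \<noteq> 0 \<and> y = peval a P' / peval a Q'"
    then obtain P' Q' where *: "Fract P Q = Fract P' Q'" "peval a Q' \<noteq> 0" "y = peval a P' / peval a Q'"
      by blast
    with assms have "Q \<noteq> 0" "Q' \<noteq> 0" by auto
    with * have "P * Q' = P' * Q" by (simp add: eq_fract)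
    then have "peval a P * peval a Q' = peval a P' * peval a Q"
      by (simp flip: peval_mult)
    with * assms show "y = peval a P / peval a Q"
      by (simp add: frac_eq_eq)
  qed
  with d show "rsubst a (Fract P Q) = peval a P / peval a Q"
    by (simp add: rsubst_def)
qed

lemma rsubst_definedE:
  assumes "rsubst_defined a f"
  obtains P Q where "f = Fract P Q" "Q \<noteq> 0" "peval a Q \<noteq> 0" "rsubst a f = peval a P / peval a Q"
proof -
  from assms obtain P Q where PQ: "f = Fract P Q" "peval a Q \<noteq> 0"
    by (auto simp: rsubst_defined_def)
  then have "Q \<noteq> 0" by auto
  with PQ show ?thesis using rsubst_Fract(2) [OF PQ(2)] that by blast
qed

lemma rsubst_Fract_1 [simp]:
  "rsubst_defined a (Fract P 1)" "rsubst a (Fract P 1) = peval a P"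
  using rsubst_Fract [of a 1 P] by simp_all

lemma rsubst_uvar [simp]: "rsubst_defined a (uvar i)" "rsubst a (uvar i) = a i"
  by (simp_all add: uvar_def)

lemma rsubst_usum [simp]: "rsubst_defined a (usum i j)" "rsubst a (usum i j) = (\<Sum>k\<in>{i..j}. a k)"
  by (simp_all add: usum_def peval_pusum)

lemma rsubst_0 [simp]: "rsubst_defined a 0" "rsubst a 0 = 0"
  using rsubst_Fract_1 [of a 0] by (simp_all flip: Zero_fract_def)

lemma rsubst_1 [simp]: "rsubst_defined a 1" "rsubst a 1 = 1"
  using rsubst_Fract_1 [of a 1] by (simp_all flip: One_fract_def)

lemma rsubst_add:
  assumes "rsubst_defined a f" "rsubst_defined a g"
  shows "rsubst_defined a (f + g)" "rsubst a (f + g) = rsubst a f + rsubst a g"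
proof -
  from assms(1) obtain P Q where 1: "f = Fract P Q" "Q \<noteq> 0" "peval a Q \<noteq> 0"
      "rsubst a f = peval a P / peval a Q"
    by (rule rsubst_definedE)
  from assms(2) obtain P' Q' where 2: "g = Fract P' Q'" "Q' \<noteq> 0" "peval a Q' \<noteq> 0"
      "rsubst a g = peval a P' / peval a Q'"
    by (rule rsubst_definedE)
  have nz: "peval a (Q * Q') \<noteq> 0" using 1 2 by (simp add: peval_mult)
  have eq: "f + g = Fract (P * Q' + P' * Q) (Q * Q')" using 1 2 by simp
  show "rsubst_defined a (f + g)" "rsubst a (f + g) = rsubst a f + rsubst a g"
    unfolding eq using rsubst_Fract [OF nz] 1 2
    by (simp_all add: peval_add peval_mult add_frac_eq)
qed

lemma rsubst_mult:
  assumes "rsubst_defined a f" "rsubst_defined a g"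
  shows "rsubst_defined a (f * g)" "rsubst a (f * g) = rsubst a f * rsubst a g"
proof -
  from assms(1) obtain P Q where 1: "f = Fract P Q" "Q \<noteq> 0" "peval a Q \<noteq> 0"
      "rsubst a f = peval a P / peval a Q"
    by (rule rsubst_definedE)
  from assms(2) obtain P' Q' where 2: "g = Fract P' Q'" "Q' \<noteq> 0" "peval a Q' \<noteq> 0"
      "rsubst a g = peval a P' / peval a Q'"
    by (rule rsubst_definedE)
  have nz: "peval a (Q * Q') \<noteq> 0" using 1 2 by (simp add: peval_mult)
  have eq: "f * g = Fract (P * P') (Q * Q')" using 1 2 by simp
  show "rsubst_defined a (f * g)" "rsubst a (f * g) = rsubst a f * rsubst a g"
    unfolding eq using rsubst_Fract [OF nz] 1 2
    by (simp_all add: peval_mult)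
qed

lemma rsubst_inverse:
  assumes "rsubst_defined a f" "rsubst a f \<noteq> 0"
  shows "rsubst_defined a (inverse f)" "rsubst a (inverse f) = inverse (rsubst a f)"
proof -
  from assms(1) obtain P Q where 1: "f = Fract P Q" "Q \<noteq> 0" "peval a Q \<noteq> 0"
      "rsubst a f = peval a P / peval a Q"
    by (rule rsubst_definedE)
  with assms have nz: "peval a P \<noteq> 0" by auto
  have eq: "inverse f = Fract Q P" using 1 by simp
  show "rsubst_defined a (inverse f)" "rsubst a (inverse f) = inverse (rsubst a f)"
    unfolding eq using rsubst_Fract [OF nz] 1 by simp_all
qed

lemma rsubst_divide:
  assumes "rsubst_defined a f" "rsubst_defined a g" "rsubst a g \<noteq> 0"
  shows "rsubst_defined a (f / g)" "rsubst a (f / g) = rsubst a f / rsubst a g"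
  using rsubst_inverse [OF assms(2,3)] rsubst_mult [OF assms(1)]
  by (simp_all add: divide_inverse)

text \<open>
  The rational numbers have at most one ring homomorphism into a given field of characteristic \<open>0\<close>.
  It identifies the coefficients \<open>of_rat c\<close> with constant fractions, and below with constant Laurent series.
\<close>

lemma coeff_hom_eq_of_rat:
  fixes \<phi> :: "rat \<Rightarrow> 'a::field_char_0"
  assumes "coeff_hom \<phi>"
  shows "\<phi> c = of_rat c"
proof -
  interpret coeff_hom \<phi> by (rule assms)
  have nat: "\<phi> (of_nat k) = of_nat k" for k
    by (induction k) (simp_all add: hom_add hom_1 hom_0)
  have "\<phi> (- x) = - \<phi> x" for x
    using hom_add [of x "- x"] hom_0 by (simp add: add_eq_0_iff)
  then have int: "\<phi> (of_int k) = of_int k" for k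
    by (cases k rule: int_cases2) (simp_all add: nat)
  obtain p q where c: "c = of_int p / of_int q" "q > 0"
    by (metis Fract_of_int_quotient Rat_cases)
  then have "\<phi> c * of_int q = of_int p"
    using hom_mult [of c "of_int q"] by (simp flip: int)
  then have "\<phi> c = of_int p / of_int q"
    using c(2) by (simp add: eq_divide_eq)
  then show ?thesis
    using c by (simp add: of_rat_divide)
qed

lemma of_rat_ratfun: "(of_rat c :: ratfun) = Fract (pconst c) 1"
proof -
  have "coeff_hom (\<lambda>c. Fract (pconst c) 1 :: ratfun)"
    by standard
      (simp_all add: pconst_hom.hom_add pconst_hom.hom_mult pconst_hom.hom_1 One_fract_def)
  from coeff_hom_eq_of_rat [OF this] show ?thesis by simp
qed

lemma rsubst_of_rat [simp]: "rsubst_defined a (of_rat c)" "rsubst a (of_rat c) = of_rat c"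
  by (simp_all add: of_rat_ratfun)

lemma rsubst_of_nat [simp]: "rsubst_defined a (of_nat k)" "rsubst a (of_nat k) = of_nat k"
  using rsubst_of_rat [of a "of_nat k"] by simp_all

lemma rsubst_sum:
  assumes "\<And>i. i \<in> A \<Longrightarrow> rsubst_defined a (f i)"
  shows "rsubst_defined a (\<Sum>i\<in>A. f i) \<and> rsubst a (\<Sum>i\<in>A. f i) = (\<Sum>i\<in>A. rsubst a (f i))"
  using assms by (induction A rule: infinite_finite_induct) (simp_all add: rsubst_add)

lemma rsubst_prod:
  assumes "\<And>i. i \<in> A \<Longrightarrow> rsubst_defined a (f i)"
  shows "rsubst_defined a (\<Prod>i\<in>A. f i) \<and> rsubst a (\<Prod>i\<in>A. f i) = (\<Prod>i\<in>A. rsubst a (f i))"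
  using assms by (induction A rule: infinite_finite_induct) (simp_all add: rsubst_mult)

lemma rsubst_power:
  assumes "rsubst_defined a f"
  shows "rsubst_defined a (f ^ k) \<and> rsubst a (f ^ k) = rsubst a f ^ k"
  using assms by (induction k) (simp_all add: rsubst_mult)

lemma rsubst_peval:
  assumes "\<And>i. i \<in> pvars P \<Longrightarrow> rsubst_defined b (a i)"
  shows "rsubst_defined b (peval a P)" "rsubst b (peval a P) = peval (\<lambda>i. rsubst b (a i)) P"
proof -
  have m: "rsubst_defined b (of_rat (Poly_Mapping.lookup P m) *
        (\<Prod>i\<in>Poly_Mapping.keys m. a i ^ Poly_Mapping.lookup m i)) \<and>
      rsubst b (of_rat (Poly_Mapping.lookup P m) *
        (\<Prod>i\<in>Poly_Mapping.keys m. a i ^ Poly_Mapping.lookup m i)) =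
      of_rat (Poly_Mapping.lookup P m) *
        (\<Prod>i\<in>Poly_Mapping.keys m. rsubst b (a i) ^ Poly_Mapping.lookup m i)"
    if "m \<in> Poly_Mapping.keys P" for m
  proof -
    have d: "rsubst_defined b (a i)" if "i \<in> Poly_Mapping.keys m" for i
      by (rule assms) (use that \<open>m \<in> _\<close> in \<open>auto simp: pvars_def\<close>)
    have p: "rsubst_defined b (a i ^ Poly_Mapping.lookup m i) \<and>
        rsubst b (a i ^ Poly_Mapping.lookup m i) = rsubst b (a i) ^ Poly_Mapping.lookup m i"
      if "i \<in> Poly_Mapping.keys m" for i
      by (rule rsubst_power) (rule d [OF that])
    have "rsubst_defined b (\<Prod>i\<in>Poly_Mapping.keys m. a i ^ Poly_Mapping.lookup m i) \<and>
        rsubst b (\<Prod>i\<in>Poly_Mapping.keys m. a i ^ Poly_Mapping.lookup m i) =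
        (\<Prod>i\<in>Poly_Mapping.keys m. rsubst b (a i ^ Poly_Mapping.lookup m i))"
      by (rule rsubst_prod) (use p in blast)
    also have "(\<Prod>i\<in>Poly_Mapping.keys m. rsubst b (a i ^ Poly_Mapping.lookup m i)) =
        (\<Prod>i\<in>Poly_Mapping.keys m. rsubst b (a i) ^ Poly_Mapping.lookup m i)"
      by (rule prod.cong) (use p in blast)+
    finally show ?thesis
      by (simp add: rsubst_mult)
  qed
  show "rsubst_defined b (peval a P)" "rsubst b (peval a P) = peval (\<lambda>i. rsubst b (a i)) P"
    using rsubst_sum [of "Poly_Mapping.keys P" b] m by (simp_all add: peval_def)
qed

text \<open>Iterated substitution, provided that it is defined.\<close>

lemma rsubst_rsubst:
  assumes "f = Fract P Q" "\<And>i. i \<in> pvars P \<union> pvars Q \<Longrightarrow> rsubst_defined b (a i)"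
    and "peval (\<lambda>i. rsubst b (a i)) Q \<noteq> 0"
  shows "rsubst_defined b (rsubst a f)" "rsubst b (rsubst a f) = rsubst (\<lambda>i. rsubst b (a i)) f"
proof -
  have P: "rsubst_defined b (peval a P)" "rsubst b (peval a P) = peval (\<lambda>i. rsubst b (a i)) P"
    by (rule rsubst_peval; use assms in blast)+
  have Q: "rsubst_defined b (peval a Q)" "rsubst b (peval a Q) = peval (\<lambda>i. rsubst b (a i)) Q"
    by (rule rsubst_peval; use assms in blast)+
  then have "peval a Q \<noteq> 0" using assms by auto
  then have "rsubst a f = peval a P / peval a Q"
    by (simp add: assms rsubst_Fract)
  then show "rsubst_defined b (rsubst a f)" "rsubst b (rsubst a f) = rsubst (\<lambda>i. rsubst b (a i)) f"
    using rsubst_divide [OF P(1) Q(1)] P Q assms by (simp_all add: rsubst_Fract)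
qed

section \<open>Functions whose denominator is a product of linear forms\<close>

text \<open>
  The pairs \<open>(i, j)\<close> that index the linear forms \<open>u\<^sub>i + \<dots> + u\<^sub>j\<close> in \<open>u\<^sub>1, \<dots>, u\<^sub>n\<close>.
\<close>

definition forms :: "nat \<Rightarrow> (nat \<times> nat) set"
  where "forms n = {(i, j). 1 \<le> i \<and> i \<le> j \<and> j \<le> n}"

text \<open>
  The product of a list of linear forms; repetitions in the list are multiplicities.
\<close>

definition psprod :: "(nat \<times> nat) list \<Rightarrow> mpoly"
  where "psprod L = prod_list (map (\<lambda>(i, j). pusum i j) L)"

lemma psprod_simps [simp]:
  "psprod [] = 1" "psprod (x # L) = pusum (fst x) (snd x) * psprod L"
  "psprod (L @ L') = psprod L * psprod L'"
  by (simp_all add: psprod_def split: prod.split)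

text \<open>
  Sequences at which no linear form \<open>u\<^sub>i + \<dots> + u\<^sub>j\<close> with \<open>1 \<le> i \<le> j \<le> n\<close> vanishes.
\<close>

definition admissible :: "nat \<Rightarrow> (nat \<Rightarrow> 'k::field_char_0) \<Rightarrow> bool"
  where "admissible n a \<longleftrightarrow> (\<forall>i j. 1 \<le> i \<longrightarrow> i \<le> j \<longrightarrow> j \<le> n \<longrightarrow> (\<Sum>k\<in>{i..j}. a k) \<noteq> 0)"

lemma peval_psprod_nonzero:
  assumes "admissible n a" "set L \<subseteq> forms n"
  shows "peval a (psprod L) \<noteq> 0"
  using assms(2)
proof (induction L)
  case (Cons x L)
  then show ?case
    using assms(1) by (auto simp: peval_mult peval_pusum admissible_def forms_def)
qed simp

lemma pusum_nonzero: "i \<le> j \<Longrightarrow> pusum i j \<noteq> 0"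
proof
  assume "i \<le> j" "pusum i j = 0"
  then have "peval (\<lambda>_. 1 :: rat) (pusum i j) = 0" by simp
  with \<open>i \<le> j\<close> show False by (simp add: peval_pusum)
qed

lemma psprod_nonzero: "set L \<subseteq> forms n \<Longrightarrow> psprod L \<noteq> 0"
  by (induction L) (auto simp: forms_def pusum_nonzero)

lemma pvars_psprod: "set L \<subseteq> forms n \<Longrightarrow> pvars (psprod L) \<subseteq> {1..n}"
proof (induction L)
  case (Cons x L)
  then show ?case
    using pvars_mult [of "pusum (fst x) (snd x)" "psprod L"] pvars_pusum [of "fst x" "snd x"]
    by (force simp: forms_def)
qed simp

lemma phom_psprod: "phom (length L) (psprod L)"
proof (induction L)
  case (Cons x L)
  then show ?case using phom_mult [OF phom_pusum] by fastforce
qed (simp add: phom_1)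

text \<open>
  Homogeneity of a degree that is an integer; the zero polynomial has every degree, including the
  negative ones.
\<close>

definition weight :: "int \<Rightarrow> mpoly \<Rightarrow> bool"
  where "weight z P \<longleftrightarrow> P = 0 \<or> (\<exists>k. z = int k \<and> phom k P)"

lemma weight_0 [simp]: "weight z 0"
  by (simp add: weight_def)

lemma weight_phom: "phom k P \<Longrightarrow> weight (int k) P"
  by (auto simp: weight_def)

lemma weight_add: "weight z P \<Longrightarrow> weight z Q \<Longrightarrow> weight z (P + Q)"
  by (auto simp: weight_def intro: phom_add)

lemma weight_mult: "weight y P \<Longrightarrow> weight z Q \<Longrightarrow> weight (y + z) (P * Q)"
  unfolding weight_def by (metis mult_zero_left mult_zero_right of_nat_add phom_mult)

text \<open>
  Fractions of degree \<open>n\<close> and weight \<open>d\<close> whose denominator is a product of linear forms.  The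
  numerator has weight \<open>d\<close> plus the number of linear forms in the denominator.
\<close>

definition nice_homogeneous :: "nat \<Rightarrow> int \<Rightarrow> ratfun \<Rightarrow> bool"
  where "nice_homogeneous n d f \<longleftrightarrow>
    (\<exists>R L. f = Fract R (psprod L) \<and> set L \<subseteq> forms n \<and> pvars R \<subseteq> {1..n} \<and> weight (d + int (length L)) R)"

lemma nice_homogeneous_Fract_1: "pvars P \<subseteq> {1..n} \<Longrightarrow> weight d P \<Longrightarrow> nice_homogeneous n d (Fract P 1)"
  unfolding nice_homogeneous_def by (rule exI [of _ P], rule exI [of _ "[]"]) simp

lemma nice_homogeneous_0: "nice_homogeneous n d 0"
  by (simp add: Zero_fract_def nice_homogeneous_Fract_1)

lemma nice_homogeneous_of_rat: "nice_homogeneous n 0 (of_rat c)"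
  using weight_phom [OF phom_pconst] by (auto simp: of_rat_ratfun intro!: nice_homogeneous_Fract_1)

lemma nice_homogeneous_1: "nice_homogeneous n 0 1"
  using nice_homogeneous_of_rat [of n 1] by simp

lemma nice_homogeneous_usum: "(i, j) \<in> forms n \<Longrightarrow> nice_homogeneous n 1 (usum i j)"
  unfolding usum_def using weight_phom [OF phom_pusum, of i j] pvars_pusum [of i j]
  by (intro nice_homogeneous_Fract_1) (auto simp: forms_def)

lemma nice_homogeneous_inverse_usum: "(i, j) \<in> forms n \<Longrightarrow> nice_homogeneous n (-1) (inverse (usum i j))"
  unfolding nice_homogeneous_def usum_def using weight_phom [OF phom_1]
  by (intro exI [of _ 1] exI [of _ "[(i, j)]"]) simp

lemma nice_homogeneous_mult:
  assumes "nice_homogeneous n d f" "nice_homogeneous n e g"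
  shows "nice_homogeneous n (d + e) (f * g)"
proof -
  from assms obtain R L R' L' where
    1: "f = Fract R (psprod L)" "set L \<subseteq> forms n" "pvars R \<subseteq> {1..n}" "weight (d + int (length L)) R"
    and 2: "g = Fract R' (psprod L')" "set L' \<subseteq> forms n" "pvars R' \<subseteq> {1..n}" "weight (e + int (length L')) R'"
    unfolding nice_homogeneous_def by blast
  have "weight (d + e + int (length (L @ L'))) (R * R')"
    using weight_mult [OF 1(4) 2(4)] by (simp add: algebra_simps)
  moreover have "pvars (R * R') \<subseteq> {1..n}"
    using 1 2 pvars_mult by fastforce
  ultimately show ?thesis
    unfolding nice_homogeneous_def using 1 2
    by (intro exI [of _ "R * R'"] exI [of _ "L @ L'"]) simp
qed

lemma nice_homogeneous_add:
  assumes "nice_homogeneous n d f" "nice_homogeneous n d g"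
  shows "nice_homogeneous n d (f + g)"
proof -
  from assms obtain R L R' L' where
    1: "f = Fract R (psprod L)" "set L \<subseteq> forms n" "pvars R \<subseteq> {1..n}" "weight (d + int (length L)) R"
    and 2: "g = Fract R' (psprod L')" "set L' \<subseteq> forms n" "pvars R' \<subseteq> {1..n}" "weight (d + int (length L')) R'"
    unfolding nice_homogeneous_def by blast
  have "weight (d + int (length (L @ L'))) (R * psprod L' + R' * psprod L)"
    using weight_mult [OF 1(4) weight_phom [OF phom_psprod [of L']]]
      weight_mult [OF 2(4) weight_phom [OF phom_psprod [of L]]]
    by (intro weight_add) (simp_all add: algebra_simps)
  moreover have "pvars (R * psprod L' + R' * psprod L) \<subseteq> {1..n}"
    using 1 2 pvars_psprod [OF 1(2)] pvars_psprod [OF 2(2)] pvars_mult [of R "psprod L'"]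
      pvars_mult [of R' "psprod L"] pvars_add [of "R * psprod L'" "R' * psprod L"]
    by blast
  ultimately show ?thesis
    unfolding nice_homogeneous_def using 1 2 psprod_nonzero
    by (intro exI [of _ "R * psprod L' + R' * psprod L"] exI [of _ "L @ L'"]) simp
qed

lemma nice_homogeneous_sum: "(\<And>i. i \<in> A \<Longrightarrow> nice_homogeneous n d (f i)) \<Longrightarrow> nice_homogeneous n d (\<Sum>i\<in>A. f i)"
  by (induction A rule: infinite_finite_induct) (auto simp: nice_homogeneous_0 nice_homogeneous_add)

lemma nice_homogeneous_power: "nice_homogeneous n 1 f \<Longrightarrow> nice_homogeneous n (int k) (f ^ k)"
  by (induction k) (auto simp: nice_homogeneous_1 dest: nice_homogeneous_mult)

lemma nice_homogeneous_prod_powers: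
  assumes "finite A" "\<And>i. i \<in> A \<Longrightarrow> nice_homogeneous n 1 (f i)"
  shows "nice_homogeneous n (int (\<Sum>i\<in>A. k i)) (\<Prod>i\<in>A. f i ^ k i)"
  using assms
proof induction
  case (insert x F)
  then show ?case
    using nice_homogeneous_mult [OF nice_homogeneous_power [of n "f x" "k x"], of "int (sum k F)"] by simp
qed (simp add: nice_homogeneous_1)

lemma nice_homogeneous_peval:
  assumes "\<And>i. i \<in> pvars P \<Longrightarrow> nice_homogeneous n 1 (a i)" "weight z P"
  shows "nice_homogeneous n z (peval a P)"
proof (cases "P = 0")
  case False
  with assms(2) obtain k where k: "z = int k" "phom k P" by (auto simp: weight_def)
  show ?thesis
    unfolding peval_def
  proof (rule nice_homogeneous_sum)
    fix m assume m: "m \<in> Poly_Mapping.keys P"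
    then have mk: "(\<Sum>i\<in>Poly_Mapping.keys m. Poly_Mapping.lookup m i) = k"
      using k by (simp add: phom_def)
    have "nice_homogeneous n (int (\<Sum>i\<in>Poly_Mapping.keys m. Poly_Mapping.lookup m i))
        (\<Prod>i\<in>Poly_Mapping.keys m. a i ^ Poly_Mapping.lookup m i)"
      by (rule nice_homogeneous_prod_powers) (use assms m in \<open>auto simp: pvars_def\<close>)
    then show "nice_homogeneous n z (of_rat (Poly_Mapping.lookup P m) *
        (\<Prod>i\<in>Poly_Mapping.keys m. a i ^ Poly_Mapping.lookup m i))"
      using nice_homogeneous_mult [OF nice_homogeneous_of_rat] mk k by fastforce
  qed
qed (simp add: nice_homogeneous_0)

text \<open>
  The class is preserved by the substitution of linear forms \<open>u\<^sub>i + \<dots> + u\<^sub>j\<close>, if their sums over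
  intervals are again such linear forms.
\<close>

lemma nice_homogeneous_rsubst:
  assumes f: "nice_homogeneous n d f"
    and a: "\<And>i j. (i, j) \<in> forms n \<Longrightarrow> \<exists>i' j'. (i', j') \<in> forms N \<and> (\<Sum>k\<in>{i..j}. a k) = usum i' j'"
  shows "nice_homogeneous N d (rsubst a f)"
proof -
  from f obtain R L where
    1: "f = Fract R (psprod L)" "set L \<subseteq> forms n" "pvars R \<subseteq> {1..n}" "weight (d + int (length L)) R"
    unfolding nice_homogeneous_def by blast
  have us: "usum i j \<noteq> 0" if "(i, j) \<in> forms N" for i j
    using that pusum_nonzero by (simp add: usum_def forms_def Zero_fract_def eq_fract)
  have ad: "admissible n a"
    unfolding admissible_def
  proof (intro allI impI)
    fix i j assume "1 \<le> i" "i \<le> j" "j \<le> n"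
    then have "(i, j) \<in> forms n" by (simp add: forms_def)
    from a [OF this] us show "(\<Sum>k\<in>{i..j}. a k) \<noteq> 0" by auto
  qed
  have ai: "nice_homogeneous N 1 (a i)" if "i \<in> {1..n}" for i
  proof -
    have "(i, i) \<in> forms n" using that by (simp add: forms_def)
    from a [OF this] nice_homogeneous_usum show ?thesis by auto
  qed
  have "nice_homogeneous N (- int (length L)) (inverse (peval a (psprod L)))"
    using 1(2)
  proof (induction L)
    case (Cons x L)
    then obtain i j where ij: "(i, j) \<in> forms N" "peval a (pusum (fst x) (snd x)) = usum i j"
      using a [of "fst x" "snd x"] by (auto simp: peval_pusum)
    show ?case
      using nice_homogeneous_mult [OF nice_homogeneous_inverse_usum [OF ij(1)] Cons.IH] Cons.prems ij
      by (simp add: peval_mult inverse_mult_distrib algebra_simps)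
  qed (simp add: nice_homogeneous_1)
  moreover have "nice_homogeneous N (d + int (length L)) (peval a R)"
    by (rule nice_homogeneous_peval) (use 1 ai in auto)
  ultimately have "nice_homogeneous N d (peval a R * inverse (peval a (psprod L)))"
    using nice_homogeneous_mult by fastforce
  then show ?thesis
    using peval_psprod_nonzero [OF ad 1(2)] by (simp add: 1(1) rsubst_Fract divide_inverse)
qed

lemma nice_homogeneous_defined: "nice_homogeneous n d f \<Longrightarrow> admissible n a \<Longrightarrow> rsubst_defined a f"
  unfolding nice_homogeneous_def using rsubst_Fract(1) peval_psprod_nonzero by metis

text \<open>
  At an admissible sequence iterated substitution needs no further assumption on denominators.
\<close>

lemma nice_homogeneous_rsubst_rsubst:
  assumes "nice_homogeneous n d f" "\<And>i. i \<in> {1..n} \<Longrightarrow> rsubst_defined b (a i)"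
    and "admissible n (\<lambda>i. rsubst b (a i))"
  shows "rsubst_defined b (rsubst a f)" "rsubst b (rsubst a f) = rsubst (\<lambda>i. rsubst b (a i)) f"
proof -
  from assms(1) obtain R L where
    1: "f = Fract R (psprod L)" "set L \<subseteq> forms n" "pvars R \<subseteq> {1..n}"
    unfolding nice_homogeneous_def by blast
  have 2: "peval (\<lambda>i. rsubst b (a i)) (psprod L) \<noteq> 0"
    by (rule peval_psprod_nonzero [OF assms(3) 1(2)])
  have 3: "rsubst_defined b (a i)" if "i \<in> pvars R \<union> pvars (psprod L)" for i
    using that 1(3) pvars_psprod [OF 1(2)] assms(2) by blast
  show "rsubst_defined b (rsubst a f)" "rsubst b (rsubst a f) = rsubst (\<lambda>i. rsubst b (a i)) f"
    by (rule rsubst_rsubst [OF 1(1) 3 2]; assumption)+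
qed

lemma admissible_cong: "(\<And>i. i \<in> {1..n} \<Longrightarrow> a i = b i) \<Longrightarrow> admissible n a \<longleftrightarrow> admissible n b"
  unfolding admissible_def by (intro all_cong1 imp_cong refl arg_cong2 [where f = "(\<noteq>)"] sum.cong) auto

lemma nice_homogeneous_rsubst_cong:
  assumes "nice_homogeneous n d f" "\<And>i. i \<in> {1..n} \<Longrightarrow> a i = b i" "admissible n a"
  shows "rsubst a f = rsubst b f"
proof -
  from assms(1) obtain R L where
    1: "f = Fract R (psprod L)" "set L \<subseteq> forms n" "pvars R \<subseteq> {1..n}"
    unfolding nice_homogeneous_def by blast
  have "peval a R = peval b R" "peval a (psprod L) = peval b (psprod L)"
    by (rule peval_cong; use assms(2) 1(3) pvars_psprod [OF 1(2)] in blast)+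
  then show ?thesis
    using peval_psprod_nonzero [OF assms(3) 1(2)] by (simp add: 1(1) rsubst_Fract)
qed

section \<open>Poles and denominators\<close>

text \<open>
  The total degree of a polynomial; it is additive because it is a degree over an integral domain.
\<close>

definition tdeg :: "mpoly \<Rightarrow> nat"
  where "tdeg P = degree (hparts P)"

lemma hparts_nonzero: "P \<noteq> 0 \<Longrightarrow> hparts P \<noteq> 0"
  using poly_hparts_1 [of P] by auto

lemma tdeg_mult: "P \<noteq> 0 \<Longrightarrow> Q \<noteq> 0 \<Longrightarrow> tdeg (P * Q) = tdeg P + tdeg Q"
  by (simp add: tdeg_def hparts_mult degree_mult_eq hparts_nonzero)

lemma tdeg_phom: "phom d P \<Longrightarrow> P \<noteq> 0 \<Longrightarrow> tdeg P = d"
  by (simp add: tdeg_def phom_iff degree_monom_eq)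

lemma tdeg_0_unit:
  assumes "tdeg P = 0" "P \<noteq> 0"
  shows "P dvd 1"
proof -
  from assms(1) obtain c where c: "hparts P = [:c:]"
    unfolding tdeg_def by (rule degree_eq_zeroE)
  have "P = poly (hparts P) 1" by (simp add: poly_hparts_1)
  also have "\<dots> = poly (hparts P) 0" by (simp add: c)
  also have "\<dots> = mev (pconst \<circ> id) (pconst \<circ> (\<lambda>_. 0)) P"
    by (simp add: poly_hparts comp_def pconst_hom.hom_0)
  also have "\<dots> = pconst (mev id (\<lambda>_. 0) P)"
    by (rule hom_mev [symmetric])
      (simp_all add: pconst_hom.hom_add pconst_hom.hom_mult pconst_hom.hom_0 pconst_hom.hom_1)
  finally obtain r where r: "P = pconst r" by blast
  with assms have "r \<noteq> 0" by (auto simp: pconst_hom.hom_0)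
  then have "P * pconst (1 / r) = 1"
    by (simp add: r flip: pconst_hom.hom_mult pconst_hom.hom_1)
  then show ?thesis by (metis dvd_triv_left)
qed

lemma irreducible_factor_exists:
  assumes "(Q :: mpoly) \<noteq> 0" "\<not> Q dvd 1"
  shows "\<exists>p. irreducible p \<and> p dvd Q"
  using assms
proof (induction "tdeg Q" arbitrary: Q rule: less_induct)
  case less
  show ?case
  proof (cases "irreducible Q")
    case False
    with less.prems obtain a b where ab: "Q = a * b" "\<not> a dvd 1" "\<not> b dvd 1"
      unfolding irreducible_def by blast
    with less.prems have nz: "a \<noteq> 0" "b \<noteq> 0" by auto
    with ab have "tdeg b \<noteq> 0" using tdeg_0_unit by blast
    with ab nz have "tdeg a < tdeg Q" by (simp add: tdeg_mult)
    with less.hyps ab nz obtain p where "irreducible p" "p dvd a" by blast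
    with ab show ?thesis by (metis dvd_mult2)
  qed auto
qed

text \<open>
  Every rational function has a representation in lowest terms, namely one whose denominator has
  minimal total degree.
\<close>

lemma lowest_terms_exist:
  "\<exists>P Q. Q \<noteq> 0 \<and> (f :: ratfun) = Fract P Q \<and> (\<forall>c. c dvd P \<longrightarrow> c dvd Q \<longrightarrow> c dvd 1)"
proof -
  define S where "S k \<longleftrightarrow> (\<exists>P Q. Q \<noteq> 0 \<and> f = Fract P Q \<and> tdeg Q = k)" for k
  have "\<exists>k. S k"
    unfolding S_def by (cases f) auto
  then have "S (LEAST k. S k)" by (rule LeastI_ex)
  then obtain P Q where PQ: "Q \<noteq> 0" "f = Fract P Q" "tdeg Q = (LEAST k. S k)"
    by (auto simp: S_def)
  have "c dvd 1" if c: "c dvd P" "c dvd Q" for c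
  proof -
    from c obtain P' Q' where eq: "P = c * P'" "Q = c * Q'" by (auto elim!: dvdE)
    with PQ have nz: "c \<noteq> 0" "Q' \<noteq> 0" by auto
    then have "f = Fract P' Q'" using PQ eq by (simp add: eq_fract)
    with nz have "S (tdeg Q')" by (auto simp: S_def)
    then have "tdeg Q \<le> tdeg Q'" using PQ by (simp add: Least_le)
    then have "tdeg c = 0" using nz eq by (simp add: tdeg_mult)
    with nz show ?thesis by (simp add: tdeg_0_unit)
  qed
  with PQ show ?thesis by blast
qed

lemma dvd_monev_diff:
  fixes l :: mpoly
  assumes "\<And>i. l dvd a i - b i"
  shows "l dvd monev a m - monev b m"
proof (induction m rule: poly_mapping_single_induct)
  case (add_single m i k)
  have mult: "l dvd x * y - x' * y'" if "l dvd x - x'" "l dvd y - y'" for x y x' y' :: mpoly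
  proof -
    have "x * y - x' * y' = (x - x') * y + x' * (y - y')" by (simp add: algebra_simps)
    with that show ?thesis by simp
  qed
  have "l dvd a i ^ k - b i ^ k"
    by (induction k) (use assms mult in simp_all)
  with add_single show ?case by (simp add: monev_add mult)
qed simp

lemma dvd_mev_diff:
  fixes l :: mpoly
  assumes "\<And>i. l dvd a i - b i"
  shows "l dvd mev pconst a P - mev pconst b P"
proof -
  have "mev pconst a P - mev pconst b P =
      (\<Sum>m\<in>Poly_Mapping.keys P. pconst (Poly_Mapping.lookup P m) * (monev a m - monev b m))"
    by (simp add: mev_def sum_subtractf right_diff_distrib)
  then show ?thesis
    using dvd_monev_diff [of l a b] assms by (simp add: dvd_sum)
qed

text \<open>A linear form \<open>u\<^sub>i + \<dots> + u\<^sub>j\<close> generates a prime ideal, since it can be used to eliminate \<open>u\<^sub>i\<close>.\<close>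

lemma pusum_prime:
  assumes "i \<le> j" "pusum i j dvd P * Q"
  shows "pusum i j dvd P \<or> pusum i j dvd Q"
proof -
  let ?l = "pusum i j"
  \<comment> \<open>The substitution that solves \<open>u\<^sub>i + \<dots> + u\<^sub>j = 0\<close> for \<open>u\<^sub>i\<close>.\<close>
  define \<sigma> where "\<sigma> = mev pconst (\<lambda>k. if k = i then pvar i - ?l else pvar k)"
  have "\<sigma> ?l = (\<Sum>k\<in>{i..j}. if k = i then pvar i - ?l else pvar k)"
    by (simp add: \<sigma>_def pconst_hom.mev_pusum)
  also have "\<dots> = (\<Sum>k\<in>{i..j}. pvar k - (if k = i then ?l else 0))"
    by (rule sum.cong) auto
  also have "\<dots> = 0"
    using assms(1) by (simp add: sum_subtractf pusum_def)
  finally have l0: "\<sigma> ?l = 0" .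
  have dvd: "?l dvd R" if "\<sigma> R = 0" for R
  proof -
    have "?l dvd mev pconst pvar R - \<sigma> R"
      unfolding \<sigma>_def by (rule dvd_mev_diff) simp
    with that show ?thesis by (simp add: mev_pconst_pvar)
  qed
  from assms(2) obtain c where "P * Q = ?l * c" by (rule dvdE)
  then have "\<sigma> P * \<sigma> Q = \<sigma> ?l * \<sigma> c"
    by (simp add: \<sigma>_def flip: pconst_hom.mev_mult)
  with l0 have "\<sigma> P = 0 \<or> \<sigma> Q = 0" by simp
  with dvd show ?thesis by blast
qed

lemma pusum_not_unit: "\<not> pusum i j dvd 1"
proof
  assume "pusum i j dvd 1"
  then obtain c where "1 = pusum i j * c" by (rule dvdE)
  then have "peval (\<lambda>_. 0 :: rat) 1 = peval (\<lambda>_. 0) (pusum i j * c)" by simp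
  then show False by (simp add: peval_mult peval_pusum)
qed

text \<open>
  The prime linear forms are removed one by one from \<open>P * psprod L = S * p\<close>: each divides \<open>S\<close>, and is
  cancelled, or it divides the irreducible polynomial \<open>p\<close>.
\<close>

lemma irreducible_dvd_psprod:
  assumes "irreducible p" "\<not> p dvd P" "P * psprod L = S * p" "set L \<subseteq> forms n"
  shows "\<exists>(i, j)\<in>forms n. p dvd pusum i j \<and> pusum i j dvd p"
  using assms(3,4)
proof (induction L arbitrary: S)
  case Nil
  with assms(2) show ?case by (metis dvd_triv_right mult.right_neutral psprod_simps(1))
next
  case (Cons x L)
  obtain i j where x: "x = (i, j)" by (cases x)
  with Cons.prems have ij: "(i, j) \<in> forms n" "i \<le> j" by (auto simp: forms_def)
  have eq: "pusum i j * (P * psprod L) = S * p" using Cons.prems(1) by (simp add: x mult_ac)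
  then have "pusum i j dvd S * p" by (metis dvd_triv_left)
  with ij consider "pusum i j dvd S" | "pusum i j dvd p" using pusum_prime by blast
  then show ?case
  proof cases
    case 1
    then obtain S' where S': "S = pusum i j * S'" by (rule dvdE)
    have "pusum i j * (P * psprod L) = pusum i j * (S' * p)"
      using eq by (simp add: S' mult_ac)
    then have "P * psprod L = S' * p"
      using pusum_nonzero [OF ij(2)] by simp
    with Cons.IH Cons.prems(2) show ?thesis by auto
  next
    case 2
    then obtain c where c: "p = pusum i j * c" by (rule dvdE)
    with assms(1) pusum_not_unit have "c dvd 1" by (metis irreducibleD)
    then obtain e where e: "1 = c * e" by (rule dvdE)
    have "p * e = pusum i j * (c * e)" by (simp add: c mult_ac)
    then have "p * e = pusum i j" by (simp flip: e)
    then have "p dvd pusum i j" by (metis dvd_triv_left)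
    with 2 ij show ?thesis by blast
  qed
qed

lemma nice_poles_psprod:
  assumes "set L \<subseteq> forms n"
  shows "nice_poles n (Fract R (psprod L))"
  unfolding nice_poles_def
proof (intro allI impI)
  fix p assume "pole (Fract R (psprod L)) p"
  then obtain P Q where p: "irreducible p" and Q: "Q \<noteq> 0" and eq: "Fract R (psprod L) = Fract P Q"
    and cop: "\<And>c. c dvd P \<Longrightarrow> c dvd Q \<Longrightarrow> c dvd 1" and pQ: "p dvd Q"
    unfolding pole_def by blast
  from pQ obtain Q' where Q': "Q = p * Q'" by (rule dvdE)
  have "P * psprod L = R * Q"
    using eq Q psprod_nonzero [OF assms] by (simp add: eq_fract)
  then have "P * psprod L = (R * Q') * p" by (simp add: Q' mult_ac)
  moreover have "\<not> p dvd P"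
    using cop pQ p by (auto simp: irreducible_def)
  ultimately have "\<exists>(i, j)\<in>forms n. p dvd pusum i j \<and> pusum i j dvd p"
    using irreducible_dvd_psprod p assms by blast
  then show "\<exists>i j. 1 \<le> i \<and> i \<le> j \<and> j \<le> n \<and> p dvd pusum i j \<and> pusum i j dvd p"
    by (auto simp: forms_def)
qed

lemma product_of_forms:
  assumes "Q \<noteq> 0" "\<And>p. irreducible p \<Longrightarrow> p dvd Q \<Longrightarrow> \<exists>(i, j)\<in>forms n. pusum i j dvd p"
  shows "\<exists>e L. e dvd 1 \<and> set L \<subseteq> forms n \<and> Q = e * psprod L"
  using assms
proof (induction "tdeg Q" arbitrary: Q rule: less_induct)
  case less
  show ?case
  proof (cases "Q dvd 1")
    case True
    then show ?thesis by (intro exI [of _ Q] exI [of _ "[]"]) simp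
  next
    case False
    then obtain p where "irreducible p" "p dvd Q"
      using irreducible_factor_exists less.prems(1) by blast
    with less.prems(2) obtain i j where ij: "(i, j) \<in> forms n" "pusum i j dvd Q"
      using dvd_trans by blast
    then obtain Q' where Q': "Q = pusum i j * Q'" by (auto elim: dvdE)
    with less.prems have nz: "Q' \<noteq> 0" "pusum i j \<noteq> 0" by auto
    then have "tdeg Q' < tdeg Q"
      by (simp add: Q' tdeg_mult tdeg_phom [OF phom_pusum])
    then have "\<exists>e L. e dvd 1 \<and> set L \<subseteq> forms n \<and> Q' = e * psprod L"
    proof (rule less.hyps)
      fix p assume "irreducible p" "p dvd Q'"
      then show "\<exists>(i, j)\<in>forms n. pusum i j dvd p"
        by (intro less.prems(2)) (simp_all add: Q')
    qed (fact nz)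
    then obtain e L where "e dvd 1" "set L \<subseteq> forms n" "Q' = e * psprod L"
      by blast
    then show ?thesis
      using ij by (intro exI [of _ e] exI [of _ "(i, j) # L"]) (simp add: Q' mult_ac)
  qed
qed

lemma nice_poles_imp_denominator:
  assumes "nice_poles n f"
  shows "\<exists>R L. set L \<subseteq> forms n \<and> f = Fract R (psprod L)"
proof -
  from lowest_terms_exist [of f]
  obtain P Q where PQ: "Q \<noteq> 0" "f = Fract P Q" "\<forall>c. c dvd P \<longrightarrow> c dvd Q \<longrightarrow> c dvd 1"
    by (elim exE conjE)
  have "\<exists>(i, j)\<in>forms n. pusum i j dvd p" if "irreducible p" "p dvd Q" for p
  proof -
    have "pole f p"
      unfolding pole_def using that PQ by (intro conjI exI [of _ P] exI [of _ Q])
    with assms obtain i j where "1 \<le> i" "i \<le> j" "j \<le> n" "pusum i j dvd p"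
      unfolding nice_poles_def by blast
    then show ?thesis by (intro bexI [of _ "(i, j)"]) (simp_all add: forms_def)
  qed
  then obtain e L where eL: "e dvd 1" "set L \<subseteq> forms n" "Q = e * psprod L"
    using product_of_forms PQ(1) by metis
  from eL(1) obtain v where v: "1 = e * v" by (rule dvdE)
  have "P * psprod L = P * (e * v) * psprod L" by (simp only: v [symmetric] mult_1_right)
  also have "\<dots> = v * P * Q" by (simp add: eL mult_ac)
  finally have "f = Fract (v * P) (psprod L)"
    using PQ psprod_nonzero [OF eL(2)] by (simp add: eq_fract)
  with eL show ?thesis by blast
qed

text \<open>
  Membership in \<open>Mould n\<close>, homogeneity and nice poles may be witnessed by three different fractions;
  together they are equivalent to the existence of a single one.
\<close>

lemma nice_homogeneous_iff:
  "nice_homogeneous n d f \<longleftrightarrow> f \<in> Mould n \<and> homogeneous d f \<and> nice_poles n f"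
proof
  assume "nice_homogeneous n d f"
  then obtain R L where
    1: "f = Fract R (psprod L)" "set L \<subseteq> forms n" "pvars R \<subseteq> {1..n}" "weight (d + int (length L)) R"
    unfolding nice_homogeneous_def by blast
  have "f \<in> Mould n"
    unfolding Mould_def using 1 psprod_nonzero [OF 1(2)] pvars_psprod [OF 1(2)] by blast
  moreover have "homogeneous d f"
  proof (cases "R = 0")
    case False
    with 1 obtain k where k: "d + int (length L) = int k" "phom k R" by (auto simp: weight_def)
    show ?thesis
      unfolding homogeneous_def
      by (rule exI [of _ R], rule exI [of _ "psprod L"], rule exI [of _ k], rule exI [of _ "length L"])
        (use k 1 psprod_nonzero [OF 1(2)] phom_psprod in auto)
  next
    case True
    have "psprod (replicate k (1, 1)) \<noteq> 0" for k
      by (rule psprod_nonzero [of _ 1]) (auto simp: forms_def set_replicate_conv_if)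
    moreover have "phom k (psprod (replicate k (1, 1)))" for k
      using phom_psprod [of "replicate k (1, 1)"] by simp
    ultimately show ?thesis
      unfolding homogeneous_def using True 1 psprod_nonzero [OF 1(2)]
      by (intro exI [of _ 0] exI [of _ "psprod (replicate (nat (- d)) (1, 1))"] exI [of _ "nat d"] exI [of _ "nat (- d)"])
        (simp add: phom_0 eq_fract)
  qed
  ultimately show "f \<in> Mould n \<and> homogeneous d f \<and> nice_poles n f"
    using nice_poles_psprod [OF 1(2)] 1(1) by simp
next
  assume *: "f \<in> Mould n \<and> homogeneous d f \<and> nice_poles n f"
  then obtain R L where RL: "set L \<subseteq> forms n" "f = Fract R (psprod L)"
    using nice_poles_imp_denominator by blast
  note nz = psprod_nonzero [OF RL(1)]
  from * obtain P Q where PQ: "f = Fract P Q" "Q \<noteq> 0" "pvars P \<subseteq> {1..n}" "pvars Q \<subseteq> {1..n}"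
    unfolding Mould_def by blast
  have eq: "R * Q = P * psprod L"
    using RL PQ nz by (simp add: eq_fract)
  \<comment> \<open>Setting the other variables to zero fixes \<open>P\<close>, \<open>Q\<close> and the denominator, hence \<open>R\<close>.\<close>
  define \<sigma> where "\<sigma> = mev pconst (\<lambda>k. if k \<in> {1..n} then pvar k else 0)"
  have \<sigma>: "\<sigma> X = X" if "pvars X \<subseteq> {1..n}" for X
  proof -
    have "\<sigma> X = mev pconst pvar X"
      unfolding \<sigma>_def by (rule mev_cong) (use that in auto)
    then show ?thesis by (simp add: mev_pconst_pvar)
  qed
  have "\<sigma> R * \<sigma> Q = \<sigma> P * \<sigma> (psprod L)"
    using eq by (simp add: \<sigma>_def flip: pconst_hom.mev_mult)
  then have "\<sigma> R * Q = R * Q"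
    using eq PQ pvars_psprod [OF RL(1)] by (simp add: \<sigma>)
  with PQ have "\<sigma> R = R" by simp
  moreover have "pvars (\<sigma> R) \<subseteq> {1..n}"
    unfolding \<sigma>_def by (rule pvars_mev_pconst) auto
  ultimately have vars: "pvars R \<subseteq> {1..n}" by simp
  from * obtain P' Q' a b where h: "Q' \<noteq> 0" "f = Fract P' Q'" "phom a P'" "phom b Q'" "int a - int b = d"
    unfolding homogeneous_def by blast
  have eq': "R * Q' = P' * psprod L"
    using RL h nz by (simp add: eq_fract)
  have "weight (d + int (length L)) R"
  proof (cases "R = 0")
    case False
    have "phom (a + length L) (R * Q')"
      unfolding eq' by (rule phom_mult [OF h(3) phom_psprod])
    from phom_factor [OF this h(4,1) False] h(5) show ?thesis
      unfolding weight_def by (auto intro!: exI [of _ "a + length L - b"])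
  qed simp
  with RL vars show "nice_homogeneous n d f"
    unfolding nice_homogeneous_def by blast
qed

section \<open>Merging consecutive variables\<close>

text \<open>
  \<open>blk i n a\<close> is the sequence \<open>a\<close> with the \<open>n\<close> entries from position \<open>i\<close> replaced by their sum, and
  \<open>seg i a\<close> is the sequence \<open>a\<close> read from position \<open>i\<close>, which becomes position \<open>1\<close>.  With them
  \<open>circ_fun\<close> is the product for arbitrary functions of sequences.
\<close>

definition blk :: "nat \<Rightarrow> nat \<Rightarrow> (nat \<Rightarrow> 'k::comm_ring_1) \<Rightarrow> nat \<Rightarrow> 'k"
  where "blk i n a = (\<lambda>k. if k < i then a k else if k = i then (\<Sum>l\<in>{i..i + n - 1}. a l)
    else a (k + n - 1))"

definition seg :: "nat \<Rightarrow> (nat \<Rightarrow> 'k) \<Rightarrow> nat \<Rightarrow> 'k"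
  where "seg i a = (\<lambda>k. a (i + k - 1))"

definition circ_fun :: "nat \<Rightarrow> nat \<Rightarrow> ((nat \<Rightarrow> 'k) \<Rightarrow> 'k) \<Rightarrow> ((nat \<Rightarrow> 'k) \<Rightarrow> 'k) \<Rightarrow>
    (nat \<Rightarrow> 'k::comm_ring_1) \<Rightarrow> 'k"
  where "circ_fun m n F G a =
    (\<Sum>i\<in>{1..m}. F (blk i n a) * G (seg i a) * (\<Sum>l\<in>{i..i + n - 1}. a l))"

text \<open>
  The sums over intervals of a merged sequence are sums over intervals of the original one.
\<close>

lemma sum_blk:
  assumes "x \<le> y" "1 \<le> n"
  shows "(\<Sum>k\<in>{x..y}. blk i n a k) =
    (\<Sum>k\<in>{(if x \<le> i then x else x + n - 1)..(if y < i then y else y + n - 1)}. a k)"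
  using assms(1)
proof (induction y rule: dec_induct)
  case base
  then show ?case by (simp add: blk_def)
next
  case (step y)
  obtain n' where n: "n = Suc n'" using assms(2) by (cases n) auto
  consider "Suc y < i" | "Suc y = i" | "Suc y > i" by linarith
  then show ?case
  proof cases
    case 2
    with step have x: "x \<le> y" "x \<le> i" by simp_all
    have "(\<Sum>k\<in>{x..y + n}. a k) = (\<Sum>k\<in>{x..y}. a k) + (\<Sum>k\<in>{y + 1..y + n}. a k)"
      by (rule sum.ub_add_nat) (use x in simp)
    moreover have "(\<Sum>k\<in>{x..y}. blk i n a k) = (\<Sum>k\<in>{x..y}. a k)"
      using 2 step.IH x by (auto split: if_splits)
    moreover have "blk i n a (Suc y) = (\<Sum>k\<in>{y + 1..y + n}. a k)"
      using 2 by (auto simp: blk_def)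
    ultimately show ?thesis
      using 2 x by (auto simp: n)
  qed (use step in \<open>auto simp: blk_def n\<close>)
qed

lemma sum_seg:
  assumes "1 \<le> x" "x \<le> y"
  shows "(\<Sum>k\<in>{x..y}. seg i a k) = (\<Sum>k\<in>{i + x - 1..i + y - 1}. a k)"
  unfolding seg_def
  by (rule sum.reindex_bij_witness [of _ "\<lambda>k. k + 1 - i" "\<lambda>k. i + k - 1"]) (use assms in auto)

lemma admissible_blk:
  assumes "admissible (m + n - 1) a" "1 \<le> n" "i \<in> {1..m}"
  shows "admissible m (blk i n a)"
  unfolding admissible_def
proof (intro allI impI)
  fix x y assume xy: "1 \<le> x" "x \<le> y" "y \<le> m"
  show "(\<Sum>k\<in>{x..y}. blk i n a k) \<noteq> 0"
    unfolding sum_blk [OF xy(2) assms(2)]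
    by (rule assms(1) [unfolded admissible_def, rule_format]) (use xy assms in auto)
qed

lemma admissible_seg:
  assumes "admissible (m + n - 1) a" "1 \<le> n" "i \<in> {1..m}"
  shows "admissible n (seg i a)"
  unfolding admissible_def
proof (intro allI impI)
  fix x y assume xy: "1 \<le> x" "x \<le> y" "y \<le> n"
  show "(\<Sum>k\<in>{x..y}. seg i a k) \<noteq> 0"
    unfolding sum_seg [OF xy(1,2)]
    by (rule assms(1) [unfolded admissible_def, rule_format]) (use xy assms in auto)
qed

lemma blk_less: "k < i \<Longrightarrow> blk i n a k = a k"
  and blk_eq: "blk i n a i = (\<Sum>l\<in>{i..i + n - 1}. a l)"
  and blk_greater: "i < k \<Longrightarrow> blk i n a k = a (k + n - 1)"
  by (simp_all add: blk_def)

text \<open>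
  Merging two blocks: the blocks may be disjoint, or one may lie inside the other.
\<close>

lemma blk_blk_apart:
  assumes "j < i" "1 \<le> n" "1 \<le> p"
  shows "blk i n (blk j p a) = blk j p (blk (i + p - 1) n a)"
proof
  fix k
  obtain n' p' where np: "n = Suc n'" "p = Suc p'"
    using assms by (cases n; cases p) auto
  have 1: "(\<Sum>l\<in>{i..i + n'}. blk j p a l) = (\<Sum>l\<in>{i + p'..i + p' + n'}. a l)"
    using assms by (subst sum_blk) (auto simp: np algebra_simps)
  have 2: "(\<Sum>l\<in>{j..j + p'}. blk (i + p') n a l) = (\<Sum>l\<in>{j..j + p'}. a l)"
    using assms by (intro sum.cong) (auto simp: blk_def np)
  consider "k < j" | "k = j" | "j < k" "k < i" | "k = i" | "i < k" by linarith
  then show "blk i n (blk j p a) k = blk j p (blk (i + p - 1) n a) k"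
  proof cases
    case 2
    then show ?thesis
      using assms by (simp add: blk_less blk_eq np \<open>sum (blk _ _ _) {j..j + p'} = _\<close> [unfolded np])
  next
    case 4
    have "blk i n (blk j p a) i = (\<Sum>l\<in>{i..i + n'}. blk j p a l)"
      by (simp add: blk_eq np)
    moreover have "blk j p (blk (i + p - 1) n a) i = (\<Sum>l\<in>{i + p'..i + p' + n'}. a l)"
      using assms by (simp add: blk_greater blk_eq np add_ac)
    ultimately show ?thesis
      using 4 1 by simp
  qed (use assms in \<open>simp_all add: blk_less blk_greater np add_ac\<close>)
qed

lemma blk_blk_inside:
  assumes "1 \<le> q" "q \<le> n" "1 \<le> p"
  shows "blk i n (blk (i + q - 1) p a) = blk i (n + p - 1) a"
proof
  fix k
  obtain n' p' q' where np: "n = Suc n'" "p = Suc p'" "q = Suc q'"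
    using assms by (cases n; cases p; cases q) auto
  have 1: "(\<Sum>l\<in>{i..i + n'}. blk (i + q') p a l) = (\<Sum>l\<in>{i..i + n' + p'}. a l)"
    using assms by (subst sum_blk) (auto simp: np algebra_simps)
  consider "k < i" | "k = i" | "i < k" by linarith
  then show "blk i n (blk (i + q - 1) p a) k = blk i (n + p - 1) a k"
  proof cases
    case 2
    then show ?thesis
      using assms by (simp add: blk_eq np 1 [unfolded np] add_ac)
  qed (use assms in \<open>simp_all add: blk_less blk_greater np add_ac\<close>)
qed

lemma seg_blk_inside:
  assumes "1 \<le> q" "1 \<le> i" "1 \<le> p"
  shows "seg i (blk (i + q - 1) p a) = blk q p (seg i a)"
proof
  fix k
  have 1: "(\<Sum>l\<in>{q..q + p - 1}. seg i a l) = (\<Sum>l\<in>{i + q - 1..i + q - 1 + p - 1}. a l)"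
    using assms by (subst sum_seg) (auto simp: algebra_simps)
  consider "k < q" | "k = q" | "q < k" by linarith
  then show "seg i (blk (i + q - 1) p a) k = blk q p (seg i a) k"
  proof cases
    case 2
    have "seg i (blk (i + q - 1) p a) q = blk (i + q - 1) p a (i + q - 1)" by (simp add: seg_def)
    then show ?thesis using 2 1 by (simp only: blk_eq)
  qed (use assms in \<open>auto simp: blk_less blk_greater seg_def intro!: arg_cong [of _ _ a]\<close>)
qed

lemma seg_seg: "1 \<le> q \<Longrightarrow> 1 \<le> i \<Longrightarrow> 1 \<le> k \<Longrightarrow> seg (i + q - 1) a k = seg q (seg i a) k"
  by (auto simp: seg_def intro: arg_cong [of _ _ a])

section \<open>The pre-Lie identity\<close>

text \<open>
  \<open>G\<close> depends only on the entries \<open>1, \<dots>, n\<close>; nothing is required outside admissible sequences.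
\<close>

definition depends_on :: "nat \<Rightarrow> ((nat \<Rightarrow> 'k::field_char_0) \<Rightarrow> 'k) \<Rightarrow> bool"
  where "depends_on n G \<longleftrightarrow>
    (\<forall>a b. admissible n a \<longrightarrow> (\<forall>k\<in>{1..n}. a k = b k) \<longrightarrow> G a = G b)"

text \<open>
  The term in which \<open>G\<close> of degree \<open>n\<close> is inserted into slot \<open>x\<close> and \<open>H\<close> of degree \<open>p\<close> into slot
  \<open>y > x\<close> of \<open>F\<close>.  The block of \<open>H\<close> starts at \<open>y + n - 1\<close> because the block of \<open>G\<close> lies before it.
\<close>

definition twoblk :: "((nat \<Rightarrow> 'k) \<Rightarrow> 'k) \<Rightarrow> nat \<Rightarrow> ((nat \<Rightarrow> 'k) \<Rightarrow> 'k) \<Rightarrow> nat \<Rightarrow> ((nat \<Rightarrow> 'k) \<Rightarrow> 'k) \<Rightarrow>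
    (nat \<Rightarrow> 'k::comm_ring_1) \<Rightarrow> nat \<Rightarrow> nat \<Rightarrow> 'k"
  where "twoblk F n G p H a x y =
    F (blk x n (blk (y + n - 1) p a)) *
    (G (seg x a) * (\<Sum>l\<in>{x..x + n - 1}. a l)) *
    (H (seg (y + n - 1) a) * (\<Sum>l\<in>{y + n - 1..y + n - 1 + p - 1}. a l))"

text \<open>
  In \<open>(F \<circ> G) \<circ> H\<close> the block of \<open>H\<close> lies before, inside or after the block of \<open>G\<close>.  The terms with
  \<open>H\<close> inside add up to \<open>F \<circ> (G \<circ> H)\<close>, and the others are exchanged by the exchange of \<open>G\<close> and \<open>H\<close>.
\<close>

lemma circ_fun_circ_fun:
  fixes a :: "nat \<Rightarrow> 'k::field_char_0"
  assumes G: "depends_on n G" and H: "depends_on p H"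
    and mnp: "1 \<le> m" "1 \<le> n" "1 \<le> p" and a: "admissible (m + n + p - 2) a"
  shows "circ_fun (m + n - 1) p (circ_fun m n F G) H a =
    circ_fun m (n + p - 1) F (circ_fun n p G H) a +
    ((\<Sum>y\<in>{1..m}. \<Sum>x\<in>{1..<y}. twoblk F n G p H a x y) +
     (\<Sum>y\<in>{1..m}. \<Sum>x\<in>{1..<y}. twoblk F p H n G a x y))"
proof -
  \<comment> \<open>the term with \<open>G\<close> in slot \<open>i\<close> of \<open>F\<close> and \<open>H\<close> in slot \<open>j\<close> of \<open>F \<circ> G\<close>\<close>
  define X where "X i j = F (blk i n (blk j p a)) * G (seg i (blk j p a)) *
    (\<Sum>l\<in>{i..i + n - 1}. blk j p a l) * (H (seg j a) * (\<Sum>l\<in>{j..j + p - 1}. a l))" for i j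
  have a3: "admissible (m + p - 1 + n - 1) a" "admissible (m + n - 1 + p - 1) a"
    using a mnp by (simp_all add: algebra_simps numeral_2_eq_2)
  have before: "X i j = twoblk F p H n G a j i" if "i \<in> {1..m}" "j \<in> {1..<i}" for i j
  proof -
    from that have ij: "j < i" "1 \<le> j" "i \<le> m" by auto
    have ad: "admissible n (seg (i + p - 1) a)"
      by (rule admissible_seg [of "m + p - 1"]) (use a3 mnp ij in auto)
    have "G (seg (i + p - 1) a) = G (seg i (blk j p a))"
      by (rule G [unfolded depends_on_def, rule_format])
        (use ij mnp ad in \<open>auto simp: seg_def blk_def algebra_simps\<close>)
    moreover have "(\<Sum>l\<in>{i..i + n - 1}. blk j p a l) = (\<Sum>l\<in>{i + p - 1..i + p - 1 + n - 1}. a l)"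
      using ij mnp by (subst sum_blk) (auto simp: algebra_simps)
    ultimately show ?thesis
      using blk_blk_apart [OF ij(1) mnp(2,3), of a] by (simp add: X_def twoblk_def mult_ac)
  qed
  have inside: "X i (i + q - 1) = F (blk i (n + p - 1) a) *
      (G (blk q p (seg i a)) * H (seg q (seg i a)) * (\<Sum>l\<in>{q..q + p - 1}. seg i a l)) *
      (\<Sum>l\<in>{i..i + (n + p - 1) - 1}. a l)" if "i \<in> {1..m}" "q \<in> {1..n}" for i q
  proof -
    from that have iq: "1 \<le> i" "1 \<le> q" "q \<le> n" "i \<le> m" by auto
    have ad: "admissible p (seg (i + q - 1) a)"
      by (rule admissible_seg [of "m + n - 1"]) (use a3 mnp iq in auto)
    have "seg (i + q - 1) a k = seg q (seg i a) k" if "k \<in> {1..p}" for k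
      by (rule seg_seg) (use iq that in auto)
    with H ad have "H (seg (i + q - 1) a) = H (seg q (seg i a))"
      unfolding depends_on_def by blast
    moreover have "(\<Sum>l\<in>{i..i + n - 1}. blk (i + q - 1) p a l) = (\<Sum>l\<in>{i..i + (n + p - 1) - 1}. a l)"
      using iq mnp by (subst sum_blk) (auto simp: algebra_simps)
    moreover have "(\<Sum>l\<in>{q..q + p - 1}. seg i a l) = (\<Sum>l\<in>{i + q - 1..i + q - 1 + p - 1}. a l)"
      using iq mnp by (subst sum_seg) (auto simp: algebra_simps)
    ultimately show ?thesis
      using blk_blk_inside [OF iq(2,3) mnp(3), of i a] seg_blk_inside [OF iq(2,1) mnp(3), of a]
      by (simp add: X_def mult_ac)
  qed
  have after: "X i (y + n - 1) = twoblk F n G p H a i y" if "i \<in> {1..m}" "y \<in> {i + 1..m}" for i y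
  proof -
    from that have iy: "i < y" "1 \<le> i" "y \<le> m" by auto
    have ad: "admissible n (seg i a)"
      by (rule admissible_seg [of "m + p - 1"]) (use a3 mnp iy in auto)
    have "G (seg i a) = G (seg i (blk (y + n - 1) p a))"
      by (rule G [unfolded depends_on_def, rule_format])
        (use iy mnp ad in \<open>auto simp: seg_def blk_def algebra_simps\<close>)
    moreover have "(\<Sum>l\<in>{i..i + n - 1}. blk (y + n - 1) p a l) = (\<Sum>l\<in>{i..i + n - 1}. a l)"
      using iy mnp by (intro sum.cong) (auto simp: blk_def)
    ultimately show ?thesis
      by (simp add: X_def twoblk_def mult_ac)
  qed
  have split: "(\<Sum>j\<in>{1..m + n - 1}. X i j) = (\<Sum>x\<in>{1..<i}. twoblk F p H n G a x i) +
      F (blk i (n + p - 1) a) * circ_fun n p G H (seg i a) * (\<Sum>l\<in>{i..i + (n + p - 1) - 1}. a l) +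
      (\<Sum>y\<in>{i + 1..m}. twoblk F n G p H a i y)" if i: "i \<in> {1..m}" for i
  proof -
    have "{1..m + n - 1} = {1..<i} \<union> ({i..i + n - 1} \<union> {i + n..m + n - 1})"
      using i mnp by auto
    then have "(\<Sum>j\<in>{1..m + n - 1}. X i j) =
        (\<Sum>j\<in>{1..<i} \<union> ({i..i + n - 1} \<union> {i + n..m + n - 1}). X i j)" by simp
    also have "\<dots> = (\<Sum>j\<in>{1..<i}. X i j) + ((\<Sum>j\<in>{i..i + n - 1}. X i j) + (\<Sum>j\<in>{i + n..m + n - 1}. X i j))"
      by (subst sum.union_disjoint; (subst sum.union_disjoint)?) (use mnp in auto)
    also have "(\<Sum>j\<in>{1..<i}. X i j) = (\<Sum>x\<in>{1..<i}. twoblk F p H n G a x i)"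
      by (rule sum.cong) (use before i in auto)
    also have "(\<Sum>j\<in>{i..i + n - 1}. X i j) = (\<Sum>q\<in>{1..n}. X i (i + q - 1))"
      by (rule sum.reindex_bij_witness [of _ "\<lambda>q. i + q - 1" "\<lambda>j. j + 1 - i"]) (use i mnp in auto)
    also have "\<dots> = (\<Sum>q\<in>{1..n}. F (blk i (n + p - 1) a) *
      (G (blk q p (seg i a)) * H (seg q (seg i a)) * (\<Sum>l\<in>{q..q + p - 1}. seg i a l)) *
      (\<Sum>l\<in>{i..i + (n + p - 1) - 1}. a l))"
      by (rule sum.cong [OF refl]) (rule inside [OF i])
    also have "\<dots> = F (blk i (n + p - 1) a) * circ_fun n p G H (seg i a) * (\<Sum>l\<in>{i..i + (n + p - 1) - 1}. a l)"
      unfolding circ_fun_def by (simp only: sum_distrib_left [where A = "{1..n}"] sum_distrib_right [where A = "{1..n}"])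
    also have "(\<Sum>j\<in>{i + n..m + n - 1}. X i j) = (\<Sum>y\<in>{i + 1..m}. X i (y + n - 1))"
      by (rule sum.reindex_bij_witness [of _ "\<lambda>y. y + n - 1" "\<lambda>j. j + 1 - n"]) (use i mnp in auto)
    also have "\<dots> = (\<Sum>y\<in>{i + 1..m}. twoblk F n G p H a i y)"
      by (rule sum.cong) (use after i in auto)
    finally show ?thesis by (simp add: add.assoc)
  qed
  have tri: "(\<Sum>i\<in>{1..m}. \<Sum>y\<in>{i + 1..m}. T i y) = (\<Sum>y\<in>{1..m}. \<Sum>x\<in>{1..<y}. T x y)"
    for T :: "nat \<Rightarrow> nat \<Rightarrow> 'k"
  proof -
    have "(\<Sum>i\<in>{1..m}. \<Sum>y\<in>{i + 1..m}. T i y) = (\<Sum>i\<in>{1..m}. \<Sum>y\<in>{y \<in> {1..m}. i < y}. T i y)"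
      by (intro sum.cong refl) auto
    also have "\<dots> = (\<Sum>y\<in>{1..m}. \<Sum>x\<in>{x \<in> {1..m}. x < y}. T x y)"
      by (rule sum.swap_restrict) simp_all
    also have "\<dots> = (\<Sum>y\<in>{1..m}. \<Sum>x\<in>{1..<y}. T x y)"
      by (intro sum.cong refl) auto
    finally show ?thesis .
  qed
  have "circ_fun (m + n - 1) p (circ_fun m n F G) H a = (\<Sum>j\<in>{1..m + n - 1}. \<Sum>i\<in>{1..m}. X i j)"
    by (simp add: circ_fun_def X_def sum_distrib_right mult.assoc)
  also have "\<dots> = (\<Sum>i\<in>{1..m}. \<Sum>j\<in>{1..m + n - 1}. X i j)"
    by (rule sum.swap)
  also have "\<dots> = (\<Sum>i\<in>{1..m}. (\<Sum>x\<in>{1..<i}. twoblk F p H n G a x i) +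
      F (blk i (n + p - 1) a) * circ_fun n p G H (seg i a) * (\<Sum>l\<in>{i..i + (n + p - 1) - 1}. a l) +
      (\<Sum>y\<in>{i + 1..m}. twoblk F n G p H a i y))"
    by (rule sum.cong) (use split in auto)
  also have "\<dots> = (\<Sum>i\<in>{1..m}. \<Sum>x\<in>{1..<i}. twoblk F p H n G a x i) +
      circ_fun m (n + p - 1) F (circ_fun n p G H) a +
      (\<Sum>i\<in>{1..m}. \<Sum>y\<in>{i + 1..m}. twoblk F n G p H a i y)"
    by (simp only: sum.distrib circ_fun_def [of m])
  finally show ?thesis
    by (simp only: tri ac_simps)
qed

section \<open>The product of nice homogeneous functions\<close>

lemma usum_eq_sum: "usum i j = (\<Sum>k\<in>{i..j}. uvar k)"
proof -
  have "Fract (P + Q) 1 = Fract P 1 + Fract Q 1" for P Q :: mpoly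
    by simp
  then have "Fract (\<Sum>k\<in>A. pvar k) 1 = (\<Sum>k\<in>A. uvar k)" for A
    by (induction A rule: infinite_finite_induct)
      (simp_all add: uvar_def Zero_fract_def del: add_fract)
  then show ?thesis by (simp add: usum_def pusum_def)
qed

lemma circ_eq_circ_fun: "circ m n f g = circ_fun m n (\<lambda>a. rsubst a f) (\<lambda>a. rsubst a g) uvar"
  unfolding circ_def circ_fun_def blk_def seg_def usum_eq_sum by (rule refl)

lemma sum_uvar_nonzero:
  assumes "finite A" "A \<noteq> {}" shows "(\<Sum>k\<in>A. uvar k) \<noteq> 0"
proof
  assume "(\<Sum>k\<in>A. uvar k) = 0"
  then have "rsubst (\<lambda>_. 1 :: rat) (\<Sum>k\<in>A. uvar k) = 0" by simp
  with assms show False using rsubst_sum [of A "\<lambda>_. 1 :: rat" uvar] by simp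
qed

lemma admissible_uvar: "admissible n uvar"
  by (simp add: admissible_def sum_uvar_nonzero)

lemma rsubst_blk_uvar [simp]:
  "rsubst_defined b (blk i n uvar k)" "rsubst b (blk i n uvar k) = blk i n b k"
  using rsubst_usum [of b i "i + n - 1"] by (simp_all add: blk_def flip: usum_eq_sum)

lemma rsubst_seg_uvar [simp]:
  "rsubst_defined b (seg i uvar k)" "rsubst b (seg i uvar k) = seg i b k"
  by (simp_all add: seg_def)

lemma rsubst_circ:
  assumes f: "nice_homogeneous m d f" and g: "nice_homogeneous n e g" and n: "1 \<le> n"
    and b: "admissible (m + n - 1) b"
  shows "rsubst_defined b (circ m n f g)"
    "rsubst b (circ m n f g) = circ_fun m n (\<lambda>a. rsubst a f) (\<lambda>a. rsubst a g) b"
proof -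
  define t where "t i = rsubst (blk i n uvar) f * rsubst (seg i uvar) g * usum i (i + n - 1)" for i
  have t: "rsubst_defined b (t i) \<and>
      rsubst b (t i) = rsubst (blk i n b) f * rsubst (seg i b) g * (\<Sum>l\<in>{i..i + n - 1}. b l)"
    if i: "i \<in> {1..m}" for i
  proof -
    have 1: "rsubst_defined b (rsubst (blk i n uvar) f)"
        "rsubst b (rsubst (blk i n uvar) f) = rsubst (blk i n b) f"
      using nice_homogeneous_rsubst_rsubst [OF f, of b "blk i n uvar"] admissible_blk [OF b n i] by simp_all
    have 2: "rsubst_defined b (rsubst (seg i uvar) g)"
        "rsubst b (rsubst (seg i uvar) g) = rsubst (seg i b) g"
      using nice_homogeneous_rsubst_rsubst [OF g, of b "seg i uvar"] admissible_seg [OF b n i] by simp_all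
    show ?thesis
      unfolding t_def using 1 2 by (simp add: rsubst_mult)
  qed
  have "circ m n f g = (\<Sum>i\<in>{1..m}. t i)"
    by (simp add: circ_eq_circ_fun circ_fun_def t_def usum_eq_sum)
  with rsubst_sum [of "{1..m}" b t] t
  show "rsubst_defined b (circ m n f g)"
    "rsubst b (circ m n f g) = circ_fun m n (\<lambda>a. rsubst a f) (\<lambda>a. rsubst a g) b"
    by (simp_all add: circ_fun_def)
qed

lemma nice_homogeneous_circ:
  assumes f: "nice_homogeneous m d f" and g: "nice_homogeneous n e g" and n: "1 \<le> n"
  shows "nice_homogeneous (m + n - 1) (d + e + 1) (circ m n f g)"
  unfolding circ_eq_circ_fun circ_fun_def
proof (rule nice_homogeneous_sum)
  fix i assume i: "i \<in> {1..m}"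
  have "nice_homogeneous (m + n - 1) d (rsubst (blk i n uvar) f)"
  proof (rule nice_homogeneous_rsubst [OF f])
    fix x y assume "(x, y) \<in> forms m"
    then have xy: "1 \<le> x" "x \<le> y" "y \<le> m" by (auto simp: forms_def)
    show "\<exists>x' y'. (x', y') \<in> forms (m + n - 1) \<and> (\<Sum>k\<in>{x..y}. blk i n uvar k) = usum x' y'"
      unfolding sum_blk [OF xy(2) n] usum_eq_sum
      by (intro exI conjI, rule_tac [2] refl) (use xy n i in \<open>auto simp: forms_def\<close>)
  qed
  moreover have "nice_homogeneous (m + n - 1) e (rsubst (seg i uvar) g)"
  proof (rule nice_homogeneous_rsubst [OF g])
    fix x y assume "(x, y) \<in> forms n"
    then have xy: "1 \<le> x" "x \<le> y" "y \<le> n" by (auto simp: forms_def)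
    show "\<exists>x' y'. (x', y') \<in> forms (m + n - 1) \<and> (\<Sum>k\<in>{x..y}. seg i uvar k) = usum x' y'"
      unfolding sum_seg [OF xy(1,2)] usum_eq_sum
      by (intro exI conjI, rule_tac [2] refl) (use xy n i in \<open>auto simp: forms_def\<close>)
  qed
  moreover have "nice_homogeneous (m + n - 1) 1 (\<Sum>l\<in>{i..i + n - 1}. uvar l)"
    unfolding usum_eq_sum [symmetric] by (rule nice_homogeneous_usum) (use i n in \<open>auto simp: forms_def\<close>)
  ultimately show "nice_homogeneous (m + n - 1) (d + e + 1) (rsubst (blk i n uvar) f *
      rsubst (seg i uvar) g * (\<Sum>l\<in>{i..i + n - 1}. uvar l))"
    by (intro nice_homogeneous_mult)
qed

lemma depends_on_rsubst: "nice_homogeneous n d g \<Longrightarrow> depends_on n (\<lambda>a. rsubst a g)"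
  unfolding depends_on_def using nice_homogeneous_rsubst_cong by blast

text \<open>The associator of functions of fixed degrees, in a form that is symmetric in \<open>g\<close> and \<open>h\<close>.\<close>

lemma circ_circ:
  assumes f: "nice_homogeneous m d f" and g: "nice_homogeneous n e g" and h: "nice_homogeneous p c h"
    and mnp: "1 \<le> m" "1 \<le> n" "1 \<le> p"
  shows "circ (m + n - 1) p (circ m n f g) h - circ m (n + p - 1) f (circ n p g h) =
    (\<Sum>y\<in>{1..m}. \<Sum>x\<in>{1..<y}.
      twoblk (\<lambda>a. rsubst a f) n (\<lambda>a. rsubst a g) p (\<lambda>a. rsubst a h) uvar x y) +
    (\<Sum>y\<in>{1..m}. \<Sum>x\<in>{1..<y}.
      twoblk (\<lambda>a. rsubst a f) p (\<lambda>a. rsubst a h) n (\<lambda>a. rsubst a g) uvar x y)"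
proof -
  let ?F = "\<lambda>a. rsubst a f" and ?G = "\<lambda>a. rsubst a g" and ?H = "\<lambda>a. rsubst a h"
  have "circ (m + n - 1) p (circ m n f g) h = circ_fun (m + n - 1) p (circ_fun m n ?F ?G) ?H uvar"
    unfolding circ_eq_circ_fun [of "m + n - 1"] circ_fun_def [of "m + n - 1"]
    by (intro sum.cong refl arg_cong2 [where f = "(*)"] rsubst_circ(2) [OF f g mnp(2)]
      admissible_blk [OF admissible_uvar mnp(3)]) assumption
  moreover have "circ m (n + p - 1) f (circ n p g h) = circ_fun m (n + p - 1) ?F (circ_fun n p ?G ?H) uvar"
    unfolding circ_eq_circ_fun [of m] circ_fun_def [of m]
    by (intro sum.cong refl arg_cong2 [where f = "(*)"] rsubst_circ(2) [OF g h mnp(3)]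
      admissible_seg [OF admissible_uvar, where m = m]) (use mnp in auto)
  ultimately show ?thesis
    using circ_fun_circ_fun [OF depends_on_rsubst [OF g] depends_on_rsubst [OF h] mnp admissible_uvar, of ?F]
    by simp
qed

lemma circ_pre_lie:
  assumes f: "nice_homogeneous m d f" and g: "nice_homogeneous n e g" and h: "nice_homogeneous p c h"
    and mnp: "1 \<le> m" "1 \<le> n" "1 \<le> p"
  shows "circ (m + n - 1) p (circ m n f g) h - circ m (n + p - 1) f (circ n p g h) =
    circ (m + p - 1) n (circ m p f h) g - circ m (p + n - 1) f (circ p n h g)"
  using circ_circ [OF f g h mnp] circ_circ [OF f h g mnp(1,3,2)] by simp

lemma circ_sum_left:
  assumes "\<And>j. j \<in> A \<Longrightarrow> nice_homogeneous m d (f j)" "1 \<le> n"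
  shows "circ m n (\<Sum>j\<in>A. f j) g = (\<Sum>j\<in>A. circ m n (f j) g)"
proof -
  have "rsubst (blk i n uvar) (\<Sum>j\<in>A. f j) = (\<Sum>j\<in>A. rsubst (blk i n uvar) (f j))"
    if i: "i \<in> {1..m}" for i
    using rsubst_sum [of A "blk i n uvar" f] assms(1) nice_homogeneous_defined
      admissible_blk [OF admissible_uvar assms(2) i] by blast
  then show ?thesis
    unfolding circ_eq_circ_fun circ_fun_def
    by (subst sum.swap) (simp add: sum_distrib_right)
qed

lemma circ_sum_right:
  assumes "\<And>j. j \<in> A \<Longrightarrow> nice_homogeneous n d (g j)" "1 \<le> n"
  shows "circ m n f (\<Sum>j\<in>A. g j) = (\<Sum>j\<in>A. circ m n f (g j))"
proof -
  have "rsubst (seg i uvar) (\<Sum>j\<in>A. g j) = (\<Sum>j\<in>A. rsubst (seg i uvar) (g j))"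
    if i: "i \<in> {1..m}" for i
    using rsubst_sum [of A "seg i uvar" g] assms(1) nice_homogeneous_defined
      admissible_seg [OF admissible_uvar assms(2) i] by blast
  then have "circ m n f (\<Sum>j\<in>A. g j) = (\<Sum>i\<in>{1..m}. \<Sum>j\<in>A.
      rsubst (blk i n uvar) f * rsubst (seg i uvar) (g j) * (\<Sum>l\<in>{i..i + n - 1}. uvar l))"
    unfolding circ_eq_circ_fun circ_fun_def
    by (intro sum.cong refl) (simp only: sum_distrib_right [where A = A] sum_distrib_left [where A = A])
  also have "\<dots> = (\<Sum>j\<in>A. circ m n f (g j))"
    unfolding circ_eq_circ_fun circ_fun_def by (rule sum.swap)
  finally show ?thesis .
qed

lemma circ_add_left:
  assumes "nice_homogeneous m d f" "nice_homogeneous m d f'" "1 \<le> n"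
  shows "circ m n (f + f') g = circ m n f g + circ m n f' g"
  using circ_sum_left [of UNIV m d "\<lambda>b. if b then f else f'" n g] assms by (simp add: UNIV_bool add.commute)

lemma circ_add_right:
  assumes "nice_homogeneous n d g" "nice_homogeneous n d g'" "1 \<le> n"
  shows "circ m n f (g + g') = circ m n f g + circ m n f g'"
  using circ_sum_right [of UNIV n d "\<lambda>b. if b then g else g'" m f] assms by (simp add: UNIV_bool add.commute)

lemma circ_scale_left:
  assumes "nice_homogeneous m d f" "1 \<le> n"
  shows "circ m n (of_rat c * f) g = of_rat c * circ m n f g"
proof -
  have "rsubst (blk i n uvar) (of_rat c * f) = of_rat c * rsubst (blk i n uvar) f"
    if i: "i \<in> {1..m}" for i
    using nice_homogeneous_defined [OF assms(1) admissible_blk [OF admissible_uvar assms(2) i]]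
    by (simp add: rsubst_mult)
  then show ?thesis
    unfolding circ_eq_circ_fun circ_fun_def sum_distrib_left
    by (intro sum.cong refl) (simp add: mult_ac)
qed

lemma circ_scale_right:
  assumes "nice_homogeneous n d g" "1 \<le> n"
  shows "circ m n f (of_rat c * g) = of_rat c * circ m n f g"
proof -
  have "rsubst (seg i uvar) (of_rat c * g) = of_rat c * rsubst (seg i uvar) g"
    if i: "i \<in> {1..m}" for i
    using nice_homogeneous_defined [OF assms(1) admissible_seg [OF admissible_uvar assms(2) i]]
    by (simp add: rsubst_mult)
  then show ?thesis
    unfolding circ_eq_circ_fun circ_fun_def sum_distrib_left
    by (intro sum.cong refl) (simp add: mult_ac)
qed

section \<open>Vegetality of the product\<close>

lemma depends_onD:
  "depends_on n G \<Longrightarrow> admissible n a \<Longrightarrow> (\<And>k. k \<in> {1..n} \<Longrightarrow> a k = b k) \<Longrightarrow> G a = G b"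
  unfolding depends_on_def by blast

text \<open>
  Sequences such that all nonempty subsums of the first \<open>n\<close> entries are nonzero: these remain
  admissible after any permutation of the entries.
\<close>

definition generic :: "nat \<Rightarrow> (nat \<Rightarrow> 'k::field_char_0) \<Rightarrow> bool"
  where "generic n u \<longleftrightarrow> (\<forall>A. A \<subseteq> {1..n} \<longrightarrow> A \<noteq> {} \<longrightarrow> (\<Sum>k\<in>A. u k) \<noteq> 0)"

lemma generic_perm_admissible:
  assumes "generic n u" "\<sigma> permutes {1..n}" "s \<noteq> 0"
  shows "admissible n (\<lambda>k. s * u (\<sigma> k))"
  unfolding admissible_def
proof (intro allI impI)
  fix i j assume ij: "1 \<le> i" "i \<le> j" "j \<le> n"
  have "(\<Sum>k\<in>{i..j}. s * u (\<sigma> k)) = s * (\<Sum>k\<in>\<sigma> ` {i..j}. u k)"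
    by (simp add: sum.reindex [OF permutes_inj_on [OF assms(2)]] sum_distrib_left)
  moreover have "\<sigma> ` {i..j} \<subseteq> {1..n}"
    using permutes_image [OF assms(2)] ij by (metis atLeastatMost_subset_iff image_mono)
  ultimately show "(\<Sum>k\<in>{i..j}. s * u (\<sigma> k)) \<noteq> 0"
    using assms(1,3) ij by (auto simp: generic_def)
qed

lemma generic_perm:
  assumes "generic n u" "\<sigma> permutes {1..n}"
  shows "generic n (u \<circ> \<sigma>)"
  unfolding generic_def
proof (intro allI impI)
  fix A assume A: "A \<subseteq> {1..n}" "A \<noteq> {}"
  have "(\<Sum>k\<in>A. (u \<circ> \<sigma>) k) = (\<Sum>k\<in>\<sigma> ` A. u k)"
    by (simp add: sum.reindex [OF permutes_inj_on [OF assms(2)]])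
  moreover have "\<sigma> ` A \<subseteq> {1..n}"
    using permutes_image [OF assms(2)] A by (metis image_mono)
  ultimately show "(\<Sum>k\<in>A. (u \<circ> \<sigma>) k) \<noteq> 0"
    using assms(1) A by (auto simp: generic_def)
qed

lemma generic_mono: "generic n u \<Longrightarrow> m \<le> n \<Longrightarrow> generic m u"
  unfolding generic_def by (meson atLeastatMost_subset_iff order.refl order.trans)

lemma generic_nonzero: "generic n u \<Longrightarrow> k \<in> {1..n} \<Longrightarrow> u k \<noteq> 0"
  unfolding generic_def by (drule spec [of _ "{k}"]) simp

text \<open>
  A subsum of the sequence with the first \<open>n\<close> entries merged is a subsum of the original sequence.
\<close>

lemma generic_blk:
  assumes "generic (m + n - 1) u" "1 \<le> n"
  shows "generic m (blk 1 n u)"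
  unfolding generic_def
proof (intro allI impI)
  fix A assume A: "A \<subseteq> {1..m}" "A \<noteq> {}"
  define B where "B = (if 1 \<in> A then {1..n} else {}) \<union> (\<lambda>k. k + n - 1) ` (A - {1})"
  have fin: "finite A" using A finite_subset by blast
  have inj: "inj_on (\<lambda>k. k + n - 1) (A - {1})"
    using assms(2) by (intro inj_onI) auto
  have gt: "n < k + n - 1" if "k \<in> A - {1}" for k
    using that A assms(2) by (auto simp: subset_eq Ball_def dest!: spec [of _ k])
  have "(\<Sum>k\<in>A - {1}. blk 1 n u k) = (\<Sum>k\<in>A - {1}. u (k + n - 1))"
    by (rule sum.cong) (use A in \<open>auto simp: blk_greater subset_eq\<close>)
  also have "\<dots> = (\<Sum>k\<in>(\<lambda>k. k + n - 1) ` (A - {1}). u k)"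
    by (subst sum.reindex [OF inj]) (simp add: comp_def)
  finally have 1: "(\<Sum>k\<in>A - {1}. blk 1 n u k) = (\<Sum>k\<in>(\<lambda>k. k + n - 1) ` (A - {1}). u k)" .
  have "(\<Sum>k\<in>A. blk 1 n u k) = (\<Sum>k\<in>B. u k)"
  proof (cases "1 \<in> A")
    case True
    have "(\<Sum>k\<in>A. blk 1 n u k) = blk 1 n u 1 + (\<Sum>k\<in>A - {1}. blk 1 n u k)"
      by (rule sum.remove [OF fin True])
    also have "\<dots> = (\<Sum>k\<in>{1..n}. u k) + (\<Sum>k\<in>(\<lambda>k. k + n - 1) ` (A - {1}). u k)"
      using assms(2) by (simp only: 1) (simp add: blk_def)
    also have "\<dots> = (\<Sum>k\<in>B. u k)"
      using True gt fin by (subst sum.union_disjoint [symmetric]) (force simp: B_def)+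
    finally show ?thesis .
  qed (use 1 in \<open>simp add: B_def\<close>)
  moreover have "B \<subseteq> {1..m + n - 1}"
  proof -
    from A obtain k where "k \<in> A" by blast
    with A have "1 \<le> m" by auto
    then have "{1..n} \<subseteq> {1..m + n - 1}" by auto
    moreover have "(\<lambda>k. k + n - 1) ` (A - {1}) \<subseteq> {1..m + n - 1}"
      using A assms(2) by (auto simp: subset_eq)
    ultimately show ?thesis by (simp add: B_def)
  qed
  moreover have "B \<noteq> {}"
    using A assms(2) by (auto simp: B_def)
  ultimately show "(\<Sum>k\<in>A. blk 1 n u k) \<noteq> 0"
    using assms(1) by (auto simp: generic_def)
qed

lemma prod_blk:
  assumes "1 \<le> m" "1 \<le> n"
  shows "(\<Prod>k\<in>{1..m}. blk 1 n u k) = (\<Sum>k\<in>{1..n}. u k) * (\<Prod>k\<in>{n + 1..m + n - 1}. u k)"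
proof -
  have "(\<Prod>k\<in>{1..m}. blk 1 n u k) = blk 1 n u 1 * (\<Prod>k\<in>{2..m}. blk 1 n u k)"
    using assms by (simp add: prod.atLeast_Suc_atMost numeral_2_eq_2)
  also have "(\<Prod>k\<in>{2..m}. blk 1 n u k) = (\<Prod>k\<in>{n + 1..m + n - 1}. u k)"
    by (rule prod.reindex_bij_witness [of _ "\<lambda>k. k + 1 - n" "\<lambda>k. k + n - 1"])
      (use assms in \<open>auto simp: blk_greater\<close>)
  also have "blk 1 n u 1 = (\<Sum>k\<in>{1..n}. u k)"
    using assms by (simp add: blk_def)
  finally show ?thesis .
qed

text \<open>
  A permutation \<open>\<pi>\<close> of the \<open>m\<close> slots with \<open>\<pi> i = 1\<close>, blown up to a permutation of
  \<open>m + n - 1\<close> positions: the \<open>n\<close> positions from \<open>i\<close> are mapped in order to \<open>1, \<dots>, n\<close>, and the other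
  slots are permuted as by \<open>\<pi>\<close>.
\<close>

definition blockperm :: "nat \<Rightarrow> nat \<Rightarrow> (nat \<Rightarrow> nat) \<Rightarrow> nat \<Rightarrow> nat \<Rightarrow> nat"
  where "blockperm m n \<pi> i k =
    (if k \<notin> {1..m + n - 1} then k
     else if k < i then \<pi> k + n - 1
     else if k < i + n then k + 1 - i
     else \<pi> (k + 1 - n) + n - 1)"

lemma blockperm_properties:
  assumes \<pi>: "\<pi> permutes {1..m}" and i: "\<pi> i = 1" and n: "1 \<le> n" and m: "1 \<le> m"
  shows "blockperm m n \<pi> i permutes {1..m + n - 1}"
    "k \<in> {1..m} \<Longrightarrow> blk i n (w \<circ> blockperm m n \<pi> i) k = blk 1 n w (\<pi> k)"
    "k \<in> {1..n} \<Longrightarrow> seg i (w \<circ> blockperm m n \<pi> i) k = w k"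
    "(\<Sum>l\<in>{i..i + n - 1}. (w \<circ> blockperm m n \<pi> i) l) = (\<Sum>l\<in>{1..n}. w l)"
proof -
  let ?b = "blockperm m n \<pi> i"
  have im: "i \<in> {1..m}"
    using permutes_in_image [OF \<pi>, of i] i m by simp
  have \<pi>eq: "\<pi> x = \<pi> y \<longleftrightarrow> x = y" for x y
    using permutes_inj [OF \<pi>] by (auto dest: injD)
  have \<pi>1: "\<pi> x \<noteq> 1" if "x \<noteq> i" for x
    using that i \<pi>eq by metis
  have \<pi>in: "2 \<le> \<pi> x" "\<pi> x \<le> m" if "x \<in> {1..m}" "x \<noteq> i" for x
    using permutes_in_image [OF \<pi>, of x] that \<pi>1 [of x] by auto
  have c1: "?b k = \<pi> k + n - 1" "n < ?b k" "?b k \<le> m + n - 1" if "1 \<le> k" "k < i" for k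
    using that im n \<pi>in [of k] by (auto simp: blockperm_def)
  have c2: "?b k = k + 1 - i" "1 \<le> ?b k" "?b k \<le> n" if "i \<le> k" "k < i + n" for k
    using that im n by (auto simp: blockperm_def)
  have c3: "?b k = \<pi> (k + 1 - n) + n - 1" "n < ?b k" "?b k \<le> m + n - 1"
    if "i + n \<le> k" "k \<le> m + n - 1" for k
  proof -
    have "k + 1 - n \<in> {1..m}" "k + 1 - n \<noteq> i" using that im n by auto
    from \<pi>in [OF this] show "?b k = \<pi> (k + 1 - n) + n - 1" "n < ?b k" "?b k \<le> m + n - 1"
      using that im n by (auto simp: blockperm_def)
  qed
  have range: "?b ` {1..m + n - 1} \<subseteq> {1..m + n - 1}"
  proof (rule image_subsetI)
    fix k assume k: "k \<in> {1..m + n - 1}"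
    consider "k < i" | "i \<le> k" "k < i + n" | "i + n \<le> k" by linarith
    then show "?b k \<in> {1..m + n - 1}"
      using c1 [of k] c2 [of k] c3 [of k] k n m by cases auto
  qed
  have inj: "inj_on ?b {1..m + n - 1}"
  proof (rule inj_onI)
    fix x y assume x: "x \<in> {1..m + n - 1}" and y: "y \<in> {1..m + n - 1}" and eq: "?b x = ?b y"
    consider "x < i" | "i \<le> x" "x < i + n" | "i + n \<le> x" by linarith
    then show "x = y"
    proof cases
      case 1
      consider "y < i" | "i \<le> y" "y < i + n" | "i + n \<le> y" by linarith
      then show ?thesis
      proof cases
        case 2
        then show ?thesis using c1 [of x] c2 [of y] 1 x eq by auto
      next
        case a: 1
        have "\<pi> x = \<pi> y" using c1(1) [of x] c1(1) [of y] 1 a x y eq n by auto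
        then show ?thesis by (simp add: \<pi>eq)
      next
        case 3
        have "\<pi> x = \<pi> (y + 1 - n)" using c1(1) [of x] c3(1) [of y] 1 3 x y eq n by auto
        then show ?thesis using 1 3 by (simp add: \<pi>eq)
      qed
    next
      case 2
      consider "y < i" | "i \<le> y" "y < i + n" | "i + n \<le> y" by linarith
      then show ?thesis
        using c2 [of x] c1 [of y] c2 [of y] c3 [of y] 2 x y eq by cases auto
    next
      case 3
      consider "y < i" | "i \<le> y" "y < i + n" | "i + n \<le> y" by linarith
      then show ?thesis
      proof cases
        case 2
        then show ?thesis using c3 [of x] c2 [of y] 3 x eq by auto
      next
        case 1
        have "\<pi> (x + 1 - n) = \<pi> y" using c3(1) [of x] c1(1) [of y] 3 1 x y eq n by auto
        then show ?thesis using 1 3 by (simp add: \<pi>eq)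
      next
        case a: 3
        have "\<pi> (x + 1 - n) + n - 1 = \<pi> (y + 1 - n) + n - 1"
          using c3(1) [of x] c3(1) [of y] 3 a x y eq by simp
        then have "\<pi> (x + 1 - n) = \<pi> (y + 1 - n)" using n by linarith
        then show ?thesis using 3 a by (simp add: \<pi>eq)
      qed
    qed
  qed
  show "?b permutes {1..m + n - 1}"
  proof (rule bij_imp_permutes)
    show "bij_betw ?b {1..m + n - 1} {1..m + n - 1}"
      unfolding bij_betw_def using inj endo_inj_surj [OF _ range inj] by blast
  qed (auto simp: blockperm_def)
  show s: "(\<Sum>l\<in>{i..i + n - 1}. (w \<circ> ?b) l) = (\<Sum>l\<in>{1..n}. w l)"
    by (rule sum.reindex_bij_witness [of _ "\<lambda>l. l + i - 1" "\<lambda>l. l + 1 - i"])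
      (use im n c2 in auto)
  show "seg i (w \<circ> ?b) k = w k" if "k \<in> {1..n}"
    using that c2(1) [of "i + k - 1"] im by (auto simp: seg_def)
  show "blk i n (w \<circ> ?b) k = blk 1 n w (\<pi> k)" if k: "k \<in> {1..m}"
  proof -
    consider "k < i" | "k = i" | "i < k" by linarith
    then show ?thesis
    proof cases
      case 1
      then show ?thesis using c1(1) [of k] \<pi>in [of k] k by (simp add: blk_less blk_greater)
    next
      case 2
      have "blk 1 n w 1 = (\<Sum>l\<in>{1..n}. w l)" using n by (simp add: blk_def)
      then show ?thesis using s 2 i by (simp only: blk_eq)
    next
      case 3
      then show ?thesis using c3(1) [of "k + n - 1"] \<pi>in [of k] k n by (simp add: blk_greater)
    qed
  qed
qed

text \<open>
  Each slot \<open>i\<close> is the preimage of \<open>1\<close> under \<open>(m - 1)!\<close> permutations.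
\<close>

lemma sum_permutations_inv_1:
  assumes "1 \<le> m"
  shows "(\<Sum>\<pi> | \<pi> permutes {1..m}. \<phi> (inv \<pi> 1)) = fact (m - 1) * (\<Sum>i\<in>{1..m::nat}. \<phi> i :: 'a::semiring_char_0)"
proof -
  have ins: "{1..m} = insert 1 {2..m}" using assms by auto
  have "(\<Sum>\<pi> | \<pi> permutes {1..m}. \<phi> (inv \<pi> 1)) = (\<Sum>\<pi> | \<pi> permutes {1..m}. \<phi> (\<pi> 1))"
    by (subst sum_permutations_inverse) (auto simp: permutes_inv_inv intro!: sum.cong)
  also have "\<dots> = (\<Sum>b\<in>{1..m}. \<Sum>q | q permutes {2..m}. \<phi> ((transpose 1 b \<circ> q) 1))"
    unfolding ins by (rule sum_over_permutations_insert) auto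
  also have "\<dots> = (\<Sum>b\<in>{1..m}. \<Sum>q | q permutes {2..m}. \<phi> b)"
  proof (intro sum.cong refl)
    fix b q assume "q \<in> {q. q permutes {2..m}}"
    then have "q 1 = 1" by (auto intro: permutes_not_in)
    then show "\<phi> ((transpose 1 b \<circ> q) 1) = \<phi> b" by simp
  qed
  also have "\<dots> = fact (m - 1) * (\<Sum>i\<in>{1..m}. \<phi> i)"
    by (simp add: card_permutations [OF refl] sum_distrib_left)
  finally show ?thesis .
qed

text \<open>
  The vegetal condition for a function of sequences in a field, at \<open>t = s\<close>, with \<open>C\<close> in the place of
  the value at the constant sequence \<open>s\<close>; it is required at generic sequences only.
\<close>

definition vegetal_fun :: "nat \<Rightarrow> ((nat \<Rightarrow> 'k::field_char_0) \<Rightarrow> 'k) \<Rightarrow> 'k \<Rightarrow> 'k \<Rightarrow> bool"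
  where "vegetal_fun n F s C \<longleftrightarrow>
    (\<forall>u. generic n u \<longrightarrow>
      (\<Prod>i\<in>{1..n}. u i) * (\<Sum>\<sigma> | \<sigma> permutes {1..n}. F (\<lambda>i. s * u (\<sigma> i))) = fact n * C)"

text \<open>
  The double averaging argument.  The sum over the slot \<open>i\<close> of the block is replaced by a sum over
  the permutations \<open>\<pi>\<close> of the slots, with \<open>i\<close> the preimage of \<open>1\<close>, and \<open>\<sigma>\<close> is composed with the
  blown up \<open>\<pi>\<close>; this moves the block to the first \<open>n\<close> positions.  The vegetal condition for
  \<open>F\<close> disposes of the sum over \<open>\<pi>\<close>.  Then \<open>\<sigma>\<close> is composed with the permutations of the first
  \<open>n\<close> positions, and the vegetal condition for \<open>G\<close> applies.
\<close>

lemma vegetal_fun_circ_fun: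
  fixes s :: "'k::field_char_0"
  assumes m: "1 \<le> m" and n: "1 \<le> n" and s: "s \<noteq> 0"
    and F: "depends_on m F" and G: "depends_on n G"
    and symF: "vegetal_fun m F s C" and symG: "vegetal_fun n G s D"
  shows "vegetal_fun (m + n - 1) (circ_fun m n F G) s (of_nat m * s * C * D)"
  unfolding vegetal_fun_def
proof (intro allI impI)
  fix u :: "nat \<Rightarrow> 'k" assume u: "generic (m + n - 1) u"
  define N where "N = m + n - 1"
  have N: "1 \<le> N" "n \<le> N" "m + n - 1 = N" using m n by (auto simp: N_def)
  define W where "W \<sigma> = (\<lambda>k. s * u (\<sigma> k))" for \<sigma> :: "nat \<Rightarrow> nat"
  define h where "h i w = F (blk i n w) * G (seg i w) * (\<Sum>l\<in>{i..i + n - 1}. w l)" for i w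
  \<comment> \<open>\<open>U\<close> is the sum of the variables in the block, \<open>V\<close> the product of those outside the block.\<close>
  define V where "V \<sigma> = (\<Prod>k\<in>{n + 1..N}. u (\<sigma> k))" for \<sigma> :: "nat \<Rightarrow> nat"
  define U where "U \<sigma> = (\<Sum>k\<in>{1..n}. u (\<sigma> k))" for \<sigma> :: "nat \<Rightarrow> nat"
  let ?P = "\<Prod>i\<in>{1..N}. u i" and ?S = "\<lambda>k. {\<sigma>. \<sigma> permutes {1..k::nat}}"
  have gen: "generic N (u \<circ> \<sigma>)" if "\<sigma> \<in> ?S N" for \<sigma>
    using generic_perm [of N u \<sigma>] u that N by simp
  have adm: "admissible N (W \<sigma>)" if "\<sigma> \<in> ?S N" for \<sigma>
    unfolding W_def using generic_perm_admissible [of N u \<sigma> s] u that s N by simp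
  have Vnz: "V \<sigma> \<noteq> 0" if "\<sigma> \<in> ?S N" for \<sigma>
    unfolding V_def using generic_nonzero [OF gen [OF that]] by auto
  have Unz: "U \<sigma> \<noteq> 0" if "\<sigma> \<in> ?S N" for \<sigma>
    unfolding U_def using gen [OF that] N n by (auto simp: generic_def)
  have Pnz: "?P \<noteq> 0"
    using generic_nonzero [OF u] N by auto

  have move: "h (inv \<pi> 1) (W (\<sigma> \<circ> blockperm m n \<pi> (inv \<pi> 1))) =
      F (\<lambda>k. s * blk 1 n (u \<circ> \<sigma>) (\<pi> k)) * (G (W \<sigma>) * (s * U \<sigma>))"
    if \<sigma>: "\<sigma> \<in> ?S N" and \<pi>: "\<pi> \<in> ?S m" for \<sigma> \<pi>
  proof -
    let ?i = "inv \<pi> 1"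
    let ?b = "blockperm m n \<pi> ?i"
    have \<pi>p: "\<pi> permutes {1..m}" using \<pi> by simp
    have i: "\<pi> ?i = 1" using permutes_inverses(1) [OF \<pi>p] .
    have im: "?i \<in> {1..m}" using permutes_in_image [OF \<pi>p, of ?i] i m by simp
    note b = blockperm_properties [OF \<pi>p i n m]
    have eq: "W (\<sigma> \<circ> ?b) = W \<sigma> \<circ> ?b" by (simp add: W_def fun_eq_iff)
    have "\<sigma> \<circ> ?b \<in> ?S N" using permutes_compose [OF b(1)] \<sigma> N by simp
    from adm [OF this] have ad: "admissible (m + n - 1) (W \<sigma> \<circ> ?b)"
      by (simp only: eq N)
    have Wblk: "blk 1 n (W \<sigma>) k = s * blk 1 n (u \<circ> \<sigma>) k" for k
      by (simp add: blk_def W_def sum_distrib_left)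
    have "blk ?i n (W \<sigma> \<circ> ?b) k = s * blk 1 n (u \<circ> \<sigma>) (\<pi> k)" if "k \<in> {1..m}" for k
      by (simp only: b(2) [OF that] Wblk)
    then have "F (blk ?i n (W \<sigma> \<circ> ?b)) = F (\<lambda>k. s * blk 1 n (u \<circ> \<sigma>) (\<pi> k))"
      by (rule depends_onD [OF F admissible_blk [OF ad n im]])
    moreover have "G (seg ?i (W \<sigma> \<circ> ?b)) = G (W \<sigma>)"
      by (rule depends_onD [OF G admissible_seg [OF ad n im]]) (rule b(3))
    moreover have "(\<Sum>l\<in>{?i..?i + n - 1}. (W \<sigma> \<circ> ?b) l) = s * U \<sigma>"
      unfolding b(4) by (simp add: W_def U_def sum_distrib_left)
    ultimately show ?thesis
      unfolding h_def eq by (simp only: mult.assoc)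
  qed

  have sumF: "(\<Sum>\<pi>\<in>?S m. F (\<lambda>k. s * blk 1 n (u \<circ> \<sigma>) (\<pi> k))) * U \<sigma> = fact m * C / V \<sigma>"
    if \<sigma>: "\<sigma> \<in> ?S N" for \<sigma>
  proof -
    have "generic m (blk 1 n (u \<circ> \<sigma>))"
      by (rule generic_blk [OF _ n]) (use gen [OF \<sigma>] N in simp)
    then have "(\<Prod>k\<in>{1..m}. blk 1 n (u \<circ> \<sigma>) k) * (\<Sum>\<pi>\<in>?S m. F (\<lambda>k. s * blk 1 n (u \<circ> \<sigma>) (\<pi> k))) = fact m * C"
      using symF unfolding vegetal_fun_def by blast
    moreover have "(\<Prod>k\<in>{1..m}. blk 1 n (u \<circ> \<sigma>) k) = U \<sigma> * V \<sigma>"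
      unfolding prod_blk [OF m n] N(3) by (simp add: U_def V_def)
    ultimately show ?thesis
      using Vnz [OF \<sigma>] by (simp add: eq_divide_eq mult_ac)
  qed

  have sumG: "(\<Sum>\<tau>\<in>?S n. G (W (\<sigma> \<circ> \<tau>)) / V (\<sigma> \<circ> \<tau>)) = fact n * D / ?P"
    if \<sigma>: "\<sigma> \<in> ?S N" for \<sigma>
  proof -
    have "generic n (u \<circ> \<sigma>)"
      by (rule generic_mono [OF gen [OF \<sigma>] N(2)])
    then have *: "(\<Prod>k\<in>{1..n}. u (\<sigma> k)) * (\<Sum>\<tau>\<in>?S n. G (W (\<sigma> \<circ> \<tau>))) = fact n * D"
      using symG unfolding vegetal_fun_def W_def comp_def by blast
    have "V (\<sigma> \<circ> \<tau>) = V \<sigma>" if "\<tau> \<in> ?S n" for \<tau>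
      unfolding V_def by (rule prod.cong) (use that permutes_not_in [of \<tau> "{1..n}"] in auto)
    then have "(\<Sum>\<tau>\<in>?S n. G (W (\<sigma> \<circ> \<tau>)) / V (\<sigma> \<circ> \<tau>)) = (\<Sum>\<tau>\<in>?S n. G (W (\<sigma> \<circ> \<tau>))) / V \<sigma>"
      by (simp add: sum_divide_distrib)
    moreover have "?P = (\<Prod>k\<in>{1..n}. u (\<sigma> k)) * V \<sigma>"
    proof -
      have "?P = (\<Prod>k\<in>{1..N}. u (\<sigma> k))"
        using prod.permute [of \<sigma> "{1..N}" u] \<sigma> by (simp add: comp_def)
      also have "\<dots> = (\<Prod>k\<in>{1..n} \<union> {n + 1..N}. u (\<sigma> k))"
        by (rule prod.cong) (use N in auto)
      also have "\<dots> = (\<Prod>k\<in>{1..n}. u (\<sigma> k)) * V \<sigma>"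
        unfolding V_def by (rule prod.union_disjoint) auto
      finally show ?thesis .
    qed
    ultimately show ?thesis
      using * Pnz Vnz [OF \<sigma>] by (simp add: frac_eq_eq mult_ac)
  qed

  have "fact (m - 1) * (\<Sum>\<sigma>\<in>?S N. circ_fun m n F G (W \<sigma>)) =
      (\<Sum>\<sigma>\<in>?S N. \<Sum>\<pi>\<in>?S m. h (inv \<pi> 1) (W \<sigma>))"
  proof -
    have "(\<Sum>\<pi>\<in>?S m. h (inv \<pi> 1) (W \<sigma>)) = fact (m - 1) * circ_fun m n F G (W \<sigma>)" for \<sigma>
      using sum_permutations_inv_1 [OF m, of "\<lambda>i. h i (W \<sigma>)"] by (simp only: circ_fun_def h_def)
    then show ?thesis by (simp only: sum_distrib_left)
  qed
  also have "\<dots> = (\<Sum>\<pi>\<in>?S m. \<Sum>\<sigma>\<in>?S N. h (inv \<pi> 1) (W \<sigma>))"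
    by (rule sum.swap)
  also have "\<dots> = (\<Sum>\<pi>\<in>?S m. \<Sum>\<sigma>\<in>?S N. F (\<lambda>k. s * blk 1 n (u \<circ> \<sigma>) (\<pi> k)) * (G (W \<sigma>) * (s * U \<sigma>)))"
  proof (rule sum.cong [OF refl])
    fix \<pi> assume \<pi>: "\<pi> \<in> ?S m"
    have p: "\<pi> permutes {1..m}" using \<pi> by simp
    have "blockperm m n \<pi> (inv \<pi> 1) permutes {1..N}"
      using blockperm_properties(1) [OF p permutes_inverses(1) [OF p] n m] N by simp
    then have "(\<Sum>\<sigma>\<in>?S N. h (inv \<pi> 1) (W \<sigma>)) =
        (\<Sum>\<sigma>\<in>?S N. h (inv \<pi> 1) (W (\<sigma> \<circ> blockperm m n \<pi> (inv \<pi> 1))))"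
      by (rule sum_permutations_compose_right)
    also have "\<dots> = (\<Sum>\<sigma>\<in>?S N. F (\<lambda>k. s * blk 1 n (u \<circ> \<sigma>) (\<pi> k)) * (G (W \<sigma>) * (s * U \<sigma>)))"
      by (rule sum.cong [OF refl]) (rule move [OF _ \<pi>])
    finally show "(\<Sum>\<sigma>\<in>?S N. h (inv \<pi> 1) (W \<sigma>)) =
        (\<Sum>\<sigma>\<in>?S N. F (\<lambda>k. s * blk 1 n (u \<circ> \<sigma>) (\<pi> k)) * (G (W \<sigma>) * (s * U \<sigma>)))" .
  qed
  also have "\<dots> = (\<Sum>\<sigma>\<in>?S N. \<Sum>\<pi>\<in>?S m. F (\<lambda>k. s * blk 1 n (u \<circ> \<sigma>) (\<pi> k)) * (G (W \<sigma>) * (s * U \<sigma>)))"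
    by (rule sum.swap)
  also have "\<dots> = (\<Sum>\<sigma>\<in>?S N. (fact m * C * s) * (G (W \<sigma>) / V \<sigma>))"
  proof (rule sum.cong [OF refl])
    fix \<sigma> assume \<sigma>: "\<sigma> \<in> ?S N"
    let ?Y = "\<Sum>\<pi>\<in>?S m. F (\<lambda>k. s * blk 1 n (u \<circ> \<sigma>) (\<pi> k))"
    have "(\<Sum>\<pi>\<in>?S m. F (\<lambda>k. s * blk 1 n (u \<circ> \<sigma>) (\<pi> k)) * (G (W \<sigma>) * (s * U \<sigma>))) =
        (?Y * U \<sigma>) * (G (W \<sigma>) * s)"
      by (simp only: sum_distrib_right [symmetric]) (simp only: mult_ac)
    also have "\<dots> = (fact m * C * s) * (G (W \<sigma>) / V \<sigma>)"
      unfolding sumF [OF \<sigma>] by simp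
    finally show "(\<Sum>\<pi>\<in>?S m. F (\<lambda>k. s * blk 1 n (u \<circ> \<sigma>) (\<pi> k)) * (G (W \<sigma>) * (s * U \<sigma>))) =
      (fact m * C * s) * (G (W \<sigma>) / V \<sigma>)" .
  qed
  also have "\<dots> = (fact m * C * s) * (\<Sum>\<sigma>\<in>?S N. G (W \<sigma>) / V \<sigma>)"
    by (simp only: sum_distrib_left)
  finally have 1: "fact (m - 1) * (\<Sum>\<sigma>\<in>?S N. circ_fun m n F G (W \<sigma>)) =
      (fact m * C * s) * (\<Sum>\<sigma>\<in>?S N. G (W \<sigma>) / V \<sigma>)" .

  have "fact n * (\<Sum>\<sigma>\<in>?S N. G (W \<sigma>) / V \<sigma>) = (\<Sum>\<tau>\<in>?S n. \<Sum>\<sigma>\<in>?S N. G (W \<sigma>) / V \<sigma>)"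
    by (simp add: card_permutations [OF refl])
  also have "\<dots> = (\<Sum>\<tau>\<in>?S n. \<Sum>\<sigma>\<in>?S N. G (W (\<sigma> \<circ> \<tau>)) / V (\<sigma> \<circ> \<tau>))"
  proof (rule sum.cong [OF refl])
    fix \<tau> assume "\<tau> \<in> ?S n"
    then have "\<tau> permutes {1..N}" using N permutes_subset [of \<tau> "{1..n}" "{1..N}"] by simp
    then show "(\<Sum>\<sigma>\<in>?S N. G (W \<sigma>) / V \<sigma>) = (\<Sum>\<sigma>\<in>?S N. G (W (\<sigma> \<circ> \<tau>)) / V (\<sigma> \<circ> \<tau>))"
      by (rule sum_permutations_compose_right)
  qed
  also have "\<dots> = (\<Sum>\<sigma>\<in>?S N. \<Sum>\<tau>\<in>?S n. G (W (\<sigma> \<circ> \<tau>)) / V (\<sigma> \<circ> \<tau>))"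
    by (rule sum.swap)
  also have "\<dots> = fact N * (fact n * D / ?P)"
    by (simp only: sumG cong: sum.cong) (simp add: card_permutations [OF refl])
  finally have "fact n * (\<Sum>\<sigma>\<in>?S N. G (W \<sigma>) / V \<sigma>) = fact n * (fact N * D / ?P)"
    by (simp only: times_divide_eq_right mult.left_commute)
  then have "(\<Sum>\<sigma>\<in>?S N. G (W \<sigma>) / V \<sigma>) = fact N * D / ?P"
    by (rule mult_left_cancel [OF fact_nonzero, THEN iffD1])
  with 1 have 2: "fact (m - 1) * (\<Sum>\<sigma>\<in>?S N. circ_fun m n F G (W \<sigma>)) = (fact m * C * s) * (fact N * D / ?P)"
    by simp
  have "(fact m :: 'k) = of_nat m * fact (m - 1)"
    using m by (simp add: fact_reduce)
  with 2 have "fact (m - 1) * (\<Sum>\<sigma>\<in>?S N. circ_fun m n F G (W \<sigma>)) =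
      fact (m - 1) * ((of_nat m * s * C * D) * fact N / ?P)"
    by (simp add: mult_ac)
  then have "(\<Sum>\<sigma>\<in>?S N. circ_fun m n F G (W \<sigma>)) = (of_nat m * s * C * D) * fact N / ?P"
    by (rule mult_left_cancel [OF fact_nonzero, THEN iffD1])
  then have "?P * (\<Sum>\<sigma>\<in>?S N. circ_fun m n F G (W \<sigma>)) = fact N * (of_nat m * s * C * D)"
    using Pnz by simp
  then show "(\<Prod>i = 1..m + n - 1. u i) *
      (\<Sum>\<sigma> | \<sigma> permutes {1..m + n - 1}. circ_fun m n F G (\<lambda>i. s * u (\<sigma> i))) =
      fact (m + n - 1) * (of_nat m * s * C * D)"
    by (simp only: N W_def)
qed

lemma generic_1: "generic n (\<lambda>_. 1)"
  by (auto simp: generic_def dest: finite_subset)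

lemma generic_uvar: "generic n uvar"
  unfolding generic_def using sum_uvar_nonzero by (metis finite_atLeastAtMost finite_subset)

lemma admissible_const: "s \<noteq> 0 \<Longrightarrow> admissible n (\<lambda>_. s)"
  unfolding admissible_def by (simp only: sum_constant mult_eq_0_iff of_nat_eq_0_iff) auto

text \<open>
  The vegetal condition is an identity of rational functions in \<open>t = u\<^sub>0\<close> and \<open>u\<^sub>1, \<dots>, u\<^sub>n\<close>, so it can
  be specialized to any field of characteristic \<open>0\<close> at generic sequences.
\<close>

lemma vegetal_imp_vegetal_fun:
  fixes s :: "'k::field_char_0"
  assumes f: "nice_homogeneous n d f" and v: "vegetal n f" and s: "s \<noteq> 0"
  shows "vegetal_fun n (\<lambda>a. rsubst a f) s (rsubst (\<lambda>_. s) f)"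
  unfolding vegetal_fun_def
proof (intro allI impI)
  fix u :: "nat \<Rightarrow> 'k" assume u: "generic n u"
  define b where "b k = (if k = 0 then s else u k)" for k
  have 1: "rsubst_defined b (rsubst (\<lambda>i. uvar 0 * uvar (\<sigma> i)) f) \<and>
      rsubst b (rsubst (\<lambda>i. uvar 0 * uvar (\<sigma> i)) f) = rsubst (\<lambda>i. s * u (\<sigma> i)) f"
    if \<sigma>: "\<sigma> permutes {1..n}" for \<sigma>
  proof -
    have ev: "rsubst_defined b (uvar 0 * uvar (\<sigma> i))" "rsubst b (uvar 0 * uvar (\<sigma> i)) = s * b (\<sigma> i)" for i
      by (simp_all add: rsubst_mult b_def)
    have eq: "s * u (\<sigma> i) = s * b (\<sigma> i)" if "i \<in> {1..n}" for i
      using permutes_in_image [OF \<sigma>, of i] that by (auto simp: b_def)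
    have a: "admissible n (\<lambda>i. s * u (\<sigma> i))"
      by (rule generic_perm_admissible [OF u \<sigma> s])
    with admissible_cong [OF eq] have a': "admissible n (\<lambda>i. rsubst b (uvar 0 * uvar (\<sigma> i)))"
      by (simp add: ev)
    show ?thesis
      using nice_homogeneous_rsubst_rsubst [OF f _ a'] nice_homogeneous_rsubst_cong [OF f eq a] by (simp add: ev)
  qed
  have 2: "rsubst_defined b (rsubst (\<lambda>_. uvar 0) f)"
      "rsubst b (rsubst (\<lambda>_. uvar 0) f) = rsubst (\<lambda>_. s) f"
    using nice_homogeneous_rsubst_rsubst [OF f, of b "\<lambda>_. uvar 0"] s
    by (simp_all add: b_def admissible_const)
  have 3: "rsubst_defined b (\<Prod>i\<in>{1..n}. uvar i) \<and> rsubst b (\<Prod>i\<in>{1..n}. uvar i) = (\<Prod>i\<in>{1..n}. u i)"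
    using rsubst_prod [of "{1..n}" b uvar] by (simp add: b_def)
  have 4: "rsubst_defined b (\<Sum>\<sigma> | \<sigma> permutes {1..n}. rsubst (\<lambda>i. uvar 0 * uvar (\<sigma> i)) f) \<and>
      rsubst b (\<Sum>\<sigma> | \<sigma> permutes {1..n}. rsubst (\<lambda>i. uvar 0 * uvar (\<sigma> i)) f) =
      (\<Sum>\<sigma> | \<sigma> permutes {1..n}. rsubst (\<lambda>i. s * u (\<sigma> i)) f)"
    using rsubst_sum [of "{\<sigma>. \<sigma> permutes {1..n}}" b] 1 by simp
  have "rsubst b ((\<Prod>i\<in>{1..n}. uvar i) * (\<Sum>\<sigma> | \<sigma> permutes {1..n}. rsubst (\<lambda>i. uvar 0 * uvar (\<sigma> i)) f)) =
      rsubst b (of_nat (fact n) * rsubst (\<lambda>_. uvar 0) f)"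
    using v by (simp add: vegetal_def Let_def)
  then show "(\<Prod>i\<in>{1..n}. u i) * (\<Sum>\<sigma> | \<sigma> permutes {1..n}. rsubst (\<lambda>i. s * u (\<sigma> i)) f) =
      fact n * rsubst (\<lambda>_. s) f"
    using 2 3 4 rsubst_of_nat [of b "fact n"] by (simp add: rsubst_mult del: of_nat_fact) simp
qed

lemma vegetal_fun_imp_vegetal:
  assumes f: "nice_homogeneous n d f" and s: "vegetal_fun n (\<lambda>a. rsubst a f) (uvar 0) (rsubst (\<lambda>_. uvar 0) f)"
  shows "vegetal n f"
proof -
  have "uvar 0 \<noteq> 0"
    using sum_uvar_nonzero [of "{0}"] by simp
  then have "rsubst_defined (\<lambda>_. uvar 0) f"
    using nice_homogeneous_defined [OF f admissible_const] by blast
  then show ?thesis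
    using s generic_uvar by (simp add: vegetal_def Let_def vegetal_fun_def)
qed

lemma uvar_nonzero: "uvar i \<noteq> 0"
  using sum_uvar_nonzero [of "{i}"] by simp

lemma vegetal_fun_circ:
  fixes s :: "'k::field_char_0"
  assumes f: "nice_homogeneous m d f" "vegetal m f" and g: "nice_homogeneous n e g" "vegetal n g"
    and m: "1 \<le> m" and n: "1 \<le> n" and s: "s \<noteq> 0"
  shows "vegetal_fun (m + n - 1) (\<lambda>a. rsubst a (circ m n f g)) s
    (of_nat m * s * rsubst (\<lambda>_. s) f * rsubst (\<lambda>_. s) g)"
  unfolding vegetal_fun_def
proof (intro allI impI)
  fix u :: "nat \<Rightarrow> 'k" assume u: "generic (m + n - 1) u"
  have "(\<Sum>\<sigma> | \<sigma> permutes {1..m + n - 1}. rsubst (\<lambda>i. s * u (\<sigma> i)) (circ m n f g)) =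
      (\<Sum>\<sigma> | \<sigma> permutes {1..m + n - 1}.
        circ_fun m n (\<lambda>a. rsubst a f) (\<lambda>a. rsubst a g) (\<lambda>i. s * u (\<sigma> i)))"
  proof (rule sum.cong [OF refl])
    fix \<sigma> assume "\<sigma> \<in> {\<sigma>. \<sigma> permutes {1..m + n - 1}}"
    then have "\<sigma> permutes {1..m + n - 1}" by simp
    from generic_perm_admissible [OF u this s]
    show "rsubst (\<lambda>i. s * u (\<sigma> i)) (circ m n f g) =
        circ_fun m n (\<lambda>a. rsubst a f) (\<lambda>a. rsubst a g) (\<lambda>i. s * u (\<sigma> i))"
      by (rule rsubst_circ(2) [OF f(1) g(1) n])
  qed
  moreover have "vegetal_fun (m + n - 1) (circ_fun m n (\<lambda>a. rsubst a f) (\<lambda>a. rsubst a g)) s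
      (of_nat m * s * rsubst (\<lambda>_. s) f * rsubst (\<lambda>_. s) g)"
    by (rule vegetal_fun_circ_fun [OF m n s depends_on_rsubst [OF f(1)] depends_on_rsubst [OF g(1)]
      vegetal_imp_vegetal_fun [OF f s] vegetal_imp_vegetal_fun [OF g s]])
  ultimately show "(\<Prod>i\<in>{1..m + n - 1}. u i) *
      (\<Sum>\<sigma> | \<sigma> permutes {1..m + n - 1}. rsubst (\<lambda>i. s * u (\<sigma> i)) (circ m n f g)) =
      fact (m + n - 1) * (of_nat m * s * rsubst (\<lambda>_. s) f * rsubst (\<lambda>_. s) g)"
    using u unfolding vegetal_fun_def by simp
qed

lemma vegetal_fun_diagonal: "vegetal_fun n F s C \<Longrightarrow> F (\<lambda>_. s) = C"
  using generic_1 [of n] by (fastforce simp: vegetal_fun_def card_permutations [OF refl])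

text \<open>
  The value of a product at a constant sequence; the factor \<open>m\<close> is the one that appears in the
  derivative of \<open>x\<^sup>m\<close>.
\<close>

lemma rsubst_const_circ:
  assumes "nice_homogeneous m d f" "vegetal m f" "nice_homogeneous n e g" "vegetal n g" "1 \<le> m" "1 \<le> n" "s \<noteq> 0"
  shows "rsubst (\<lambda>_. s) (circ m n f g) = of_nat m * s * rsubst (\<lambda>_. s) f * rsubst (\<lambda>_. s) g"
  by (rule vegetal_fun_diagonal [OF vegetal_fun_circ [OF assms]])

lemma vegetal_circ:
  assumes "nice_homogeneous m d f" "vegetal m f" "nice_homogeneous n e g" "vegetal n g" "1 \<le> m" "1 \<le> n"
  shows "vegetal (m + n - 1) (circ m n f g)"
  using vegetal_fun_circ [OF assms uvar_nonzero] rsubst_const_circ [OF assms uvar_nonzero]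
  by (intro vegetal_fun_imp_vegetal [OF nice_homogeneous_circ [OF assms(1,3,6)]]) simp

lemma vegetal_0: "vegetal n 0"
  by (simp add: vegetal_def)

lemma generic_admissible_uvar:
  "\<sigma> permutes {1..n} \<Longrightarrow> admissible n (\<lambda>i. uvar 0 * uvar (\<sigma> i))"
  by (rule generic_perm_admissible [OF generic_uvar _ uvar_nonzero])

lemma vegetal_add:
  assumes f: "nice_homogeneous n d f" "vegetal n f" and g: "nice_homogeneous n d g" "vegetal n g"
  shows "vegetal n (f + g)"
proof -
  have "rsubst (\<lambda>i. uvar 0 * uvar (\<sigma> i)) (f + g) =
      rsubst (\<lambda>i. uvar 0 * uvar (\<sigma> i)) f + rsubst (\<lambda>i. uvar 0 * uvar (\<sigma> i)) g"
    if "\<sigma> permutes {1..n}" for \<sigma>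
    using nice_homogeneous_defined [OF f(1) generic_admissible_uvar [OF that]]
      nice_homogeneous_defined [OF g(1) generic_admissible_uvar [OF that]] by (rule rsubst_add)
  then have "(\<Sum>\<sigma> | \<sigma> permutes {1..n}. rsubst (\<lambda>i. uvar 0 * uvar (\<sigma> i)) (f + g)) =
      (\<Sum>\<sigma> | \<sigma> permutes {1..n}. rsubst (\<lambda>i. uvar 0 * uvar (\<sigma> i)) f) +
      (\<Sum>\<sigma> | \<sigma> permutes {1..n}. rsubst (\<lambda>i. uvar 0 * uvar (\<sigma> i)) g)"
    by (simp add: sum.distrib)
  then show ?thesis
    using f(2) g(2) by (simp add: vegetal_def Let_def rsubst_add distrib_left)
qed

lemma vegetal_scale:
  assumes f: "nice_homogeneous n d f" "vegetal n f"
  shows "vegetal n (of_rat c * f)"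
proof -
  have "rsubst (\<lambda>i. uvar 0 * uvar (\<sigma> i)) (of_rat c * f) =
      of_rat c * rsubst (\<lambda>i. uvar 0 * uvar (\<sigma> i)) f"
    if "\<sigma> permutes {1..n}" for \<sigma>
    using nice_homogeneous_defined [OF f(1) generic_admissible_uvar [OF that]] by (simp add: rsubst_mult)
  then have "(\<Sum>\<sigma> | \<sigma> permutes {1..n}. rsubst (\<lambda>i. uvar 0 * uvar (\<sigma> i)) (of_rat c * f)) =
      of_rat c * (\<Sum>\<sigma> | \<sigma> permutes {1..n}. rsubst (\<lambda>i. uvar 0 * uvar (\<sigma> i)) f)"
    by (simp add: sum_distrib_left)
  then show ?thesis
    using f(2) by (simp add: vegetal_def Let_def rsubst_mult mult.left_commute)
qed

section \<open>The pre-Lie algebra of moulds\<close>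

lemma vegetal_moulds_iff:
  "f \<in> vegetal_moulds \<longleftrightarrow>
    f 0 = 0 \<and> (\<forall>n\<ge>1. nice_homogeneous n (- int n) (f n) \<and> vegetal n (f n))"
  by (auto simp: vegetal_moulds_def moulds_def nice_homogeneous_iff)

lemma mould_scale_apply: "mould_scale c f n = of_rat c * f n"
  by (simp add: mould_scale_def)

lemma vegetal_mouldsD:
  assumes "f \<in> vegetal_moulds" "1 \<le> n"
  shows "nice_homogeneous n (- int n) (f n)" "vegetal n (f n)"
  using assms by (simp_all add: vegetal_moulds_iff)

lemma vegetal_moulds_0: "0 \<in> vegetal_moulds"
  by (simp add: vegetal_moulds_iff nice_homogeneous_0 vegetal_0)

lemma vegetal_moulds_add: "f \<in> vegetal_moulds \<Longrightarrow> g \<in> vegetal_moulds \<Longrightarrow> f + g \<in> vegetal_moulds"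
  by (auto simp: vegetal_moulds_iff intro: nice_homogeneous_add vegetal_add)

lemma nice_homogeneous_scale: "nice_homogeneous n d f \<Longrightarrow> nice_homogeneous n d (of_rat c * f)"
  using nice_homogeneous_mult [OF nice_homogeneous_of_rat] by fastforce

lemma vegetal_moulds_scale: "f \<in> vegetal_moulds \<Longrightarrow> mould_scale c f \<in> vegetal_moulds"
  by (auto simp: vegetal_moulds_iff mould_scale_def intro: nice_homogeneous_scale vegetal_scale)

lemma circ_vegetal_moulds:
  assumes "f \<in> vegetal_moulds" "g \<in> vegetal_moulds" "1 \<le> m" "1 \<le> n" "m + n = N + 1"
  shows "nice_homogeneous N (- int N) (circ m n (f m) (g n))" "vegetal N (circ m n (f m) (g n))"
proof -
  have N: "m + n - 1 = N" "- int m + - int n + 1 = - int N" using assms by simp_all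
  note f = vegetal_mouldsD [OF assms(1,3)] and g = vegetal_mouldsD [OF assms(2,4)]
  show "nice_homogeneous N (- int N) (circ m n (f m) (g n))"
    using nice_homogeneous_circ [OF f(1) g(1) assms(4)] by (simp only: N)
  show "vegetal N (circ m n (f m) (g n))"
    using vegetal_circ [OF f g assms(3,4)] by (simp only: N)
qed

lemma vegetal_sum:
  assumes "\<And>i. i \<in> A \<Longrightarrow> nice_homogeneous n d (f i) \<and> vegetal n (f i)"
  shows "vegetal n (\<Sum>i\<in>A. f i)"
  using assms
  by (induction A rule: infinite_finite_induct) (auto simp: vegetal_0 intro!: vegetal_add nice_homogeneous_sum)

lemma vegetal_moulds_circ:
  assumes "f \<in> vegetal_moulds" "g \<in> vegetal_moulds"
  shows "mould_circ f g \<in> vegetal_moulds"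
  unfolding vegetal_moulds_iff
proof (intro conjI allI impI)
  show "mould_circ f g 0 = 0" by (simp add: mould_circ_def)
next
  fix N :: nat assume "1 \<le> N"
  have *: "nice_homogeneous N (- int N) (circ m (N + 1 - m) (f m) (g (N + 1 - m))) \<and>
      vegetal N (circ m (N + 1 - m) (f m) (g (N + 1 - m)))" if "m \<in> {1..N}" for m
    by (intro conjI circ_vegetal_moulds [OF assms]) (use that in auto)
  show "nice_homogeneous N (- int N) (mould_circ f g N)"
    unfolding mould_circ_def using * by (intro nice_homogeneous_sum) blast
  show "vegetal N (mould_circ f g N)"
    unfolding mould_circ_def using * by (rule vegetal_sum)
qed

text \<open>
  Both iterated products are sums over the degrees \<open>m, n, p \<ge> 1\<close> with \<open>m + n + p = N + 2\<close>, written as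
  sums over \<open>m\<close> and \<open>n\<close>.
\<close>

lemma mould_circ_circ_left:
  assumes "f \<in> vegetal_moulds" "g \<in> vegetal_moulds"
  shows "mould_circ (mould_circ f g) h N =
    (\<Sum>m\<in>{1..N}. \<Sum>n\<in>{1..N + 1 - m}.
      circ (m + n - 1) (N + 2 - m - n) (circ m n (f m) (g n)) (h (N + 2 - m - n)))"
proof -
  define T where "T m n = circ (m + n - 1) (N + 2 - m - n) (circ m n (f m) (g n)) (h (N + 2 - m - n))" for m n
  have "mould_circ (mould_circ f g) h N = (\<Sum>M\<in>{1..N}. \<Sum>m\<in>{1..M}. T m (M + 1 - m))"
    unfolding mould_circ_def [of "mould_circ f g"]
  proof (rule sum.cong [OF refl])
    fix M assume M: "M \<in> {1..N}"
    have "circ M (N + 1 - M) (mould_circ f g M) (h (N + 1 - M)) =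
        (\<Sum>m\<in>{1..M}. circ M (N + 1 - M) (circ m (M + 1 - m) (f m) (g (M + 1 - m))) (h (N + 1 - M)))"
      unfolding mould_circ_def
      by (rule circ_sum_left [where d = "- int M"], rule circ_vegetal_moulds [OF assms])
        (use M in auto)
    also have "\<dots> = (\<Sum>m\<in>{1..M}. T m (M + 1 - m))"
    proof (rule sum.cong [OF refl])
      fix m assume "m \<in> {1..M}"
      then have "m + (M + 1 - m) - 1 = M" "N + 2 - m - (M + 1 - m) = N + 1 - M" by auto
      then show "circ M (N + 1 - M) (circ m (M + 1 - m) (f m) (g (M + 1 - m))) (h (N + 1 - M)) = T m (M + 1 - m)"
        unfolding T_def by (simp only:)
    qed
    finally show "circ M (N + 1 - M) (mould_circ f g M) (h (N + 1 - M)) = (\<Sum>m\<in>{1..M}. T m (M + 1 - m))" .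
  qed
  also have "\<dots> = (\<Sum>(M, m)\<in>(SIGMA M:{1..N}. {1..M}). T m (M + 1 - m))"
    by (rule sum.Sigma) auto
  also have "\<dots> = (\<Sum>(m, n)\<in>(SIGMA m:{1..N}. {1..N + 1 - m}). T m n)"
    by (rule sum.reindex_bij_witness [of _ "\<lambda>(m, n). (m + n - 1, m)" "\<lambda>(M, m). (m, M + 1 - m)"]) auto
  also have "\<dots> = (\<Sum>m\<in>{1..N}. \<Sum>n\<in>{1..N + 1 - m}. T m n)"
    by (rule sum.Sigma [symmetric]) auto
  finally show ?thesis by (simp only: T_def)
qed

lemma mould_circ_circ_right:
  assumes "g \<in> vegetal_moulds" "h \<in> vegetal_moulds"
  shows "mould_circ f (mould_circ g h) N =
    (\<Sum>m\<in>{1..N}. \<Sum>n\<in>{1..N + 1 - m}.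
      circ m (N + 1 - m) (f m) (circ n (N + 2 - m - n) (g n) (h (N + 2 - m - n))))"
  unfolding mould_circ_def [of f]
proof (rule sum.cong [OF refl])
  fix m assume m: "m \<in> {1..N}"
  have "circ m (N + 1 - m) (f m) (mould_circ g h (N + 1 - m)) = (\<Sum>n\<in>{1..N + 1 - m}.
      circ m (N + 1 - m) (f m) (circ n (N + 1 - m + 1 - n) (g n) (h (N + 1 - m + 1 - n))))"
    unfolding mould_circ_def
    by (rule circ_sum_right [where d = "- int (N + 1 - m)"], rule circ_vegetal_moulds [OF assms])
      (use m in auto)
  moreover have "N + 1 - m + 1 - n = N + 2 - m - n" for n using m by auto
  ultimately show "circ m (N + 1 - m) (f m) (mould_circ g h (N + 1 - m)) =
      (\<Sum>n\<in>{1..N + 1 - m}.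
        circ m (N + 1 - m) (f m) (circ n (N + 2 - m - n) (g n) (h (N + 2 - m - n))))"
    by (simp only:)
qed

lemma mould_circ_pre_lie:
  assumes f: "f \<in> vegetal_moulds" and g: "g \<in> vegetal_moulds" and h: "h \<in> vegetal_moulds"
  shows "mould_circ (mould_circ f g) h - mould_circ f (mould_circ g h) =
    mould_circ (mould_circ f h) g - mould_circ f (mould_circ h g)"
proof
  fix N
  define A where "A g h m n p =
    circ (m + n - 1) p (circ m n (f m) (g n)) (h p) - circ m (N + 1 - m) (f m) (circ n p (g n) (h p))"
    for g h :: "nat \<Rightarrow> ratfun" and m n p
  have diff: "(mould_circ (mould_circ f g) h - mould_circ f (mould_circ g h)) N =
      (\<Sum>m\<in>{1..N}. \<Sum>n\<in>{1..N + 1 - m}. A g h m n (N + 2 - m - n))"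
    if "g \<in> vegetal_moulds" "h \<in> vegetal_moulds" for g h
    by (simp only: minus_apply mould_circ_circ_left [OF f that(1)] mould_circ_circ_right [OF that]
      A_def sum_subtractf)
  have "(\<Sum>n\<in>{1..N + 1 - m}. A g h m n (N + 2 - m - n)) = (\<Sum>n\<in>{1..N + 1 - m}. A h g m n (N + 2 - m - n))"
    if m: "m \<in> {1..N}" for m
  proof -
    have "(\<Sum>n\<in>{1..N + 1 - m}. A g h m n (N + 2 - m - n)) =
        (\<Sum>n\<in>{1..N + 1 - m}. A h g m (N + 2 - m - n) n)"
    proof (rule sum.cong [OF refl])
      fix n assume n: "n \<in> {1..N + 1 - m}"
      define p where "p = N + 2 - m - n"
      have mnp: "1 \<le> m" "1 \<le> n" "1 \<le> p" "n + p - 1 = N + 1 - m" "p + n - 1 = N + 1 - m"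
        using m n by (auto simp: p_def)
      have "A g h m n p = A h g m p n"
        using circ_pre_lie [OF vegetal_mouldsD(1) [OF f mnp(1)] vegetal_mouldsD(1) [OF g mnp(2)]
          vegetal_mouldsD(1) [OF h mnp(3)] mnp(1,2,3)]
        unfolding A_def mnp(4,5) .
      then show "A g h m n (N + 2 - m - n) = A h g m (N + 2 - m - n) n"
        by (simp only: p_def)
    qed
    also have "\<dots> = (\<Sum>n\<in>{1..N + 1 - m}. A h g m n (N + 2 - m - n))"
      by (rule sum.reindex_bij_witness [of _ "\<lambda>n. N + 2 - m - n" "\<lambda>n. N + 2 - m - n"])
        (use m in auto)
    finally show ?thesis .
  qed
  then show "(mould_circ (mould_circ f g) h - mould_circ f (mould_circ g h)) N =
      (mould_circ (mould_circ f h) g - mould_circ f (mould_circ h g)) N"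
    unfolding diff [OF g h] diff [OF h g] by (rule sum.cong [OF refl])
qed

lemma mould_circ_add_left:
  assumes "f \<in> vegetal_moulds" "f' \<in> vegetal_moulds"
  shows "mould_circ (f + f') g = mould_circ f g + mould_circ f' g"
proof
  fix N
  have "circ m (N + 1 - m) ((f + f') m) (g (N + 1 - m)) =
      circ m (N + 1 - m) (f m) (g (N + 1 - m)) + circ m (N + 1 - m) (f' m) (g (N + 1 - m))"
    if "m \<in> {1..N}" for m
    unfolding plus_fun_apply
    by (rule circ_add_left [where d = "- int m"]) (use that assms vegetal_mouldsD in auto)
  then show "mould_circ (f + f') g N = (mould_circ f g + mould_circ f' g) N"
    unfolding plus_fun_apply mould_circ_def sum.distrib [symmetric] by (intro sum.cong refl)
qed

lemma mould_circ_add_right: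
  assumes "g \<in> vegetal_moulds" "g' \<in> vegetal_moulds"
  shows "mould_circ f (g + g') = mould_circ f g + mould_circ f g'"
proof
  fix N
  have "circ m (N + 1 - m) (f m) ((g + g') (N + 1 - m)) =
      circ m (N + 1 - m) (f m) (g (N + 1 - m)) + circ m (N + 1 - m) (f m) (g' (N + 1 - m))"
    if "m \<in> {1..N}" for m
    unfolding plus_fun_apply
    by (rule circ_add_right; (rule vegetal_mouldsD(1) [OF assms(1)] vegetal_mouldsD(1) [OF assms(2)])?)
      (use that in auto)
  then show "mould_circ f (g + g') N = (mould_circ f g + mould_circ f g') N"
    unfolding plus_fun_apply mould_circ_def sum.distrib [symmetric] by (intro sum.cong refl)
qed

lemma mould_circ_scale_left:
  assumes "f \<in> vegetal_moulds"
  shows "mould_circ (mould_scale c f) g = mould_scale c (mould_circ f g)"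
proof
  fix N
  have "circ m (N + 1 - m) (mould_scale c f m) (g (N + 1 - m)) =
      of_rat c * circ m (N + 1 - m) (f m) (g (N + 1 - m))" if "m \<in> {1..N}" for m
    unfolding mould_scale_apply
    by (rule circ_scale_left [where d = "- int m"]) (use that assms vegetal_mouldsD in auto)
  then show "mould_circ (mould_scale c f) g N = mould_scale c (mould_circ f g) N"
    unfolding mould_scale_apply [of c "mould_circ f g"] unfolding mould_circ_def sum_distrib_left
    by (intro sum.cong refl)
qed

lemma mould_circ_scale_right:
  assumes "g \<in> vegetal_moulds"
  shows "mould_circ f (mould_scale c g) = mould_scale c (mould_circ f g)"
proof
  fix N
  have "circ m (N + 1 - m) (f m) (mould_scale c g (N + 1 - m)) =
      of_rat c * circ m (N + 1 - m) (f m) (g (N + 1 - m))" if "m \<in> {1..N}" for m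
    unfolding mould_scale_apply
    by (rule circ_scale_right; (rule vegetal_mouldsD(1) [OF assms])?) (use that in auto)
  then show "mould_circ f (mould_scale c g) N = mould_scale c (mould_circ f g) N"
    unfolding mould_scale_apply [of c "mould_circ f g"] unfolding mould_circ_def sum_distrib_left
    by (intro sum.cong refl)
qed

lemma pre_lie_algebra_moulds: "pre_lie_algebra mould_scale vegetal_moulds mould_circ"
proof -
  interpret vector_space mould_scale
    by unfold_locales
      (auto simp: mould_scale_def fun_eq_iff algebra_simps of_rat_add of_rat_mult)
  show ?thesis
  proof
    show "subspace vegetal_moulds"
      by (rule subspaceI) (auto intro: vegetal_moulds_0 vegetal_moulds_add vegetal_moulds_scale)
  qed (auto intro: vegetal_moulds_circ mould_circ_add_left mould_circ_add_right
      mould_circ_scale_left mould_circ_scale_right mould_circ_pre_lie)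
qed

section \<open>Substitution of the inverse of the variable\<close>

lemma peval_const:
  assumes "phom k P"
  shows "peval (\<lambda>_. s) P = of_rat (peval (\<lambda>_. 1) P) * s ^ k"
proof -
  have "peval (\<lambda>_. s) P = (\<Sum>m\<in>Poly_Mapping.keys P. of_rat (Poly_Mapping.lookup P m) * s ^ k)"
    unfolding peval_def
    by (rule sum.cong) (use assms in \<open>simp_all add: phom_def flip: power_sum\<close>)
  then show ?thesis
    by (simp add: peval_def of_rat_sum sum_distrib_right)
qed

text \<open>
  A homogeneous function of weight \<open>-e\<close> at a constant sequence, in terms of its rational value at
  \<open>(1, \<dots>, 1)\<close>.
\<close>

lemma rsubst_const:
  assumes "nice_homogeneous n (- int e) f" "s \<noteq> 0"
  shows "rsubst (\<lambda>_. s) f = of_rat (rsubst (\<lambda>_. 1) f) * inverse s ^ e"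
proof -
  from assms(1) obtain R L where
    1: "f = Fract R (psprod L)" "set L \<subseteq> forms n" "weight (- int e + int (length L)) R"
    unfolding nice_homogeneous_def by blast
  have L: "peval (\<lambda>_. 1 :: rat) (psprod L) \<noteq> 0" "peval (\<lambda>_. s) (psprod L) \<noteq> 0"
    by (rule peval_psprod_nonzero [OF _ 1(2)], rule admissible_const, use assms(2) in simp)+
  have eL: "peval (\<lambda>_. s) (psprod L) = of_rat (peval (\<lambda>_. 1) (psprod L)) * s ^ length L"
    by (rule peval_const [OF phom_psprod])
  show ?thesis
  proof (cases "R = 0")
    case False
    with 1(3) obtain k where k: "- int e + int (length L) = int k" "phom k R"
      by (auto simp: weight_def)
    then have "length L = k + e" by linarith
    then show ?thesis
      using L assms(2) eL peval_const [OF k(2), of s]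
      by (simp add: 1(1) rsubst_Fract of_rat_divide power_add field_simps)
  qed (use L in \<open>simp add: 1(1) rsubst_Fract\<close>)
qed

lemma of_rat_fls: "(of_rat c :: rat fls) = fls_const c"
proof -
  have "coeff_hom (fls_const :: rat \<Rightarrow> rat fls)"
    by standard (simp_all add: fls_plus_const fls_const_mult_const)
  from coeff_hom_eq_of_rat [OF this] show ?thesis by simp
qed

text \<open>
  A power series is the sum of its monomials in the topology of Laurent series.
\<close>

lemma fps_monomials_sums:
  fixes F :: "'a::ring_1 fps"
  shows "(\<lambda>n. fps_to_fls (fps_const (fps_nth F n) * fps_X ^ n)) sums fps_to_fls F"
  unfolding sums_def
proof (rule metric_LIMSEQ_I)
  fix r :: real assume "0 < r"
  then obtain k where k: "inverse (2 ^ k) < r"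
    using real_arch_pow_inv [of r "1 / 2"] by (auto simp: field_simps power_one_over)
  have "dist (\<Sum>i<n. fps_to_fls (fps_const (fps_nth F i) * fps_X ^ i)) (fps_to_fls F) < r" if "n \<ge> k" for n
  proof -
    define S where "S = (\<Sum>i<n. fps_const (fps_nth F i) * fps_X ^ i)"
    have sum: "(\<Sum>i<n. fps_to_fls (fps_const (fps_nth F i) * fps_X ^ i)) = fps_to_fls S"
    proof -
      have "fps_to_fls (\<Sum>i\<in>A. h i) = (\<Sum>i\<in>A. fps_to_fls (h i))" for A :: "nat set" and h :: "nat \<Rightarrow> 'a fps"
        by (induction A rule: infinite_finite_induct) simp_all
      then show ?thesis by (simp add: S_def)
    qed
    have nth: "fps_nth (S - F) j = 0" if "j < n" for j
      using that by (simp add: S_def fps_sum_nth fps_X_power_iff if_distrib cong: if_cong)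
    show ?thesis
    proof (cases "S = F")
      case False
      then have "n \<le> subdegree (S - F)"
        by (intro subdegree_geI nth) auto
      then have "inverse (2 ^ subdegree (S - F)) \<le> (inverse (2 ^ k) :: real)"
        using that by (simp add: power_increasing)
      moreover have "dist (fps_to_fls S) (fps_to_fls F) = inverse (2 ^ subdegree (S - F))"
        using False by (simp add: dist_fls_def fls_subdegree_fls_to_fps flip: fps_to_fls_minus)
      ultimately show ?thesis unfolding sum using k by linarith
    qed (use \<open>0 < r\<close> sum in simp)
  qed
  then show "\<exists>N. \<forall>n\<ge>N. dist (\<Sum>i<n. fps_to_fls (fps_const (fps_nth F i) * fps_X ^ i)) (fps_to_fls F) < r"
    by blast
qed

text \<open>
  The power series \<open>\<Sum>\<^sub>n f\<^sub>n(1, \<dots>, 1) x\<^sup>n\<close>, the coefficient of the image of \<open>f\<close>.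
\<close>

definition diagonal_series :: "(nat \<Rightarrow> ratfun) \<Rightarrow> rat fps"
  where "diagonal_series f = Abs_fps (\<lambda>n. if n = 0 then 0 else rsubst (\<lambda>_. 1) (f n))"

lemma diagonal_series_nth: "fps_nth (diagonal_series f) n = (if n = 0 then 0 else rsubst (\<lambda>_. 1) (f n))"
  by (simp add: diagonal_series_def)

lemma at_x_inv_sums:
  assumes "f \<in> vegetal_moulds"
  shows "(\<lambda>n. at_x_inv (f (Suc n))) sums fps_to_fls (diagonal_series f)"
proof -
  have eq: "at_x_inv (f (Suc n)) = fps_to_fls (fps_const (fps_nth (diagonal_series f) (Suc n)) * fps_X ^ Suc n)" for n
  proof -
    have "at_x_inv (f (Suc n)) = fls_const (fps_nth (diagonal_series f) (Suc n)) * fls_X ^ Suc n"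
      unfolding at_x_inv_def
      by (subst rsubst_const [OF vegetal_mouldsD(1) [OF assms]]) (simp_all add: of_rat_fls diagonal_series_nth)
    then show ?thesis
      by (simp only: fls_times_fps_to_fls fps_to_fls_power fps_const_to_fls fps_X_to_fls)
  qed
  define g where "g n = fps_to_fls (fps_const (fps_nth (diagonal_series f) n) * fps_X ^ n)" for n
  have "(\<Sum>i<n. g (Suc i)) = (\<Sum>i<Suc n. g i)" for n
    unfolding sum.lessThan_Suc_shift by (simp add: g_def diagonal_series_nth)
  moreover have "(\<lambda>n. \<Sum>i<Suc n. g i) \<longlonglongrightarrow> fps_to_fls (diagonal_series f)"
    using fps_monomials_sums [of "diagonal_series f"] unfolding sums_def g_def by (rule LIMSEQ_Suc)
  ultimately show ?thesis
    unfolding sums_def eq g_def by simp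
qed

lemma mould_to_vf_eq: "f \<in> vegetal_moulds \<Longrightarrow> mould_to_vf f = diagonal_series f"
  by (simp only: mould_to_vf_def sums_unique [OF at_x_inv_sums, symmetric] fls_regpart_fps_trivial)

lemma diagonal_series_add:
  assumes "f \<in> vegetal_moulds" "g \<in> vegetal_moulds"
  shows "diagonal_series (f + g) = diagonal_series f + diagonal_series g"
proof (rule fps_ext)
  fix n
  have "rsubst (\<lambda>_. 1 :: rat) (f n + g n) = rsubst (\<lambda>_. 1) (f n) + rsubst (\<lambda>_. 1) (g n)" if "n \<noteq> 0"
    by (rule rsubst_add(2); rule nice_homogeneous_defined [OF vegetal_mouldsD(1) admissible_const])
      (use assms that in auto)
  then show "fps_nth (diagonal_series (f + g)) n = fps_nth (diagonal_series f + diagonal_series g) n"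
    by (simp add: diagonal_series_nth)
qed

lemma diagonal_series_scale:
  assumes "f \<in> vegetal_moulds"
  shows "diagonal_series (mould_scale c f) = vf_scale c (diagonal_series f)"
proof (rule fps_ext)
  fix n
  have "rsubst (\<lambda>_. 1 :: rat) (of_rat c * f n) = c * rsubst (\<lambda>_. 1) (f n)" if "n \<noteq> 0"
  proof -
    have "rsubst_defined (\<lambda>_. 1 :: rat) (f n)"
      by (rule nice_homogeneous_defined [OF vegetal_mouldsD(1) admissible_const]) (use assms that in auto)
    then show ?thesis by (simp add: rsubst_mult)
  qed
  then show "fps_nth (diagonal_series (mould_scale c f)) n = fps_nth (vf_scale c (diagonal_series f)) n"
    by (simp add: diagonal_series_nth mould_scale_def vf_scale_def)
qed

lemma diagonal_series_mould_circ:
  assumes f: "f \<in> vegetal_moulds" and g: "g \<in> vegetal_moulds"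
  shows "diagonal_series (mould_circ f g) = vf_circ (diagonal_series f) (diagonal_series g)"
proof (rule fps_ext)
  fix N
  let ?c = "\<lambda>f n. rsubst (\<lambda>_. 1 :: rat) (f n)"
  have "?c (mould_circ f g) N = (\<Sum>m\<in>{1..N}. of_nat m * ?c f m * ?c g (N + 1 - m))"
  proof -
    have t: "rsubst_defined (\<lambda>_. 1 :: rat) (circ m (N + 1 - m) (f m) (g (N + 1 - m))) \<and>
        rsubst (\<lambda>_. 1 :: rat) (circ m (N + 1 - m) (f m) (g (N + 1 - m))) =
          of_nat m * ?c f m * ?c g (N + 1 - m)"
      if m: "m \<in> {1..N}" for m
    proof -
      have m1: "1 \<le> m" "1 \<le> N + 1 - m" "m + (N + 1 - m) = N + 1" using m by auto
      have "rsubst_defined (\<lambda>_. 1 :: rat) (circ m (N + 1 - m) (f m) (g (N + 1 - m)))"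
        by (rule nice_homogeneous_defined [OF circ_vegetal_moulds(1) [OF f g m1] admissible_const]) simp
      then show ?thesis
        using rsubst_const_circ [OF vegetal_mouldsD [OF f m1(1)] vegetal_mouldsD [OF g m1(2)] m1(1,2), of "1 :: rat"]
        by simp
    qed
    then show ?thesis
      unfolding mould_circ_def
      using rsubst_sum [of "{1..N}" "\<lambda>_. 1 :: rat" "\<lambda>m. circ m (N + 1 - m) (f m) (g (N + 1 - m))"]
      by simp
  qed
  also have "\<dots> = (\<Sum>m\<in>{1..N}. of_nat m * fps_nth (diagonal_series f) m * fps_nth (diagonal_series g) (N + 1 - m))"
    by (rule sum.cong) (auto simp: diagonal_series_nth)
  also have "\<dots> = (\<Sum>i\<in>{0..<N}. of_nat (i + 1) * fps_nth (diagonal_series f) (i + 1) * fps_nth (diagonal_series g) (N - i))"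
    by (rule sum.reindex_bij_witness [of _ "\<lambda>i. i + 1" "\<lambda>m. m - 1"]) auto
  also have "\<dots> = (\<Sum>i\<in>{0..N}. of_nat (i + 1) * fps_nth (diagonal_series f) (i + 1) * fps_nth (diagonal_series g) (N - i))"
    by (rule sum.mono_neutral_left) (auto simp: diagonal_series_nth)
  also have "\<dots> = fps_nth (vf_circ (diagonal_series f) (diagonal_series g)) N"
    by (simp add: vf_circ_def fps_mult_nth)
  finally have *: "?c (mould_circ f g) N = fps_nth (vf_circ (diagonal_series f) (diagonal_series g)) N" .
  show "fps_nth (diagonal_series (mould_circ f g)) N = fps_nth (vf_circ (diagonal_series f) (diagonal_series g)) N"
    unfolding * [symmetric] diagonal_series_nth by (simp add: mould_circ_def)
qed

lemma pre_lie_algebra_vector_fields: "pre_lie_algebra vf_scale UNIV vf_circ"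
proof -
  interpret vector_space vf_scale
    by unfold_locales (simp_all add: vf_scale_def distrib_left distrib_right mult.assoc
      fps_const_add [symmetric] fps_const_mult [symmetric] del: fps_const_add fps_const_mult)
  show ?thesis
    by unfold_locales
      (simp_all add: vf_scale_def vf_circ_def algebra_simps subspace_UNIV)
qed

theorem theorem6p3:
  shows "(\<forall>f\<in>vegetal_moulds.
            (\<forall>n\<ge>1. rsubst_defined (\<lambda>_. inverse (fls_X :: rat fls)) (f n)) \<and>
            (\<lambda>n. at_x_inv (f (Suc n))) sums fps_to_fls (mould_to_vf f)) \<and>
         pre_lie_morphism
           mould_scale vegetal_moulds mould_circ
           vf_scale UNIV vf_circ
           mould_to_vf"
proof (intro conjI ballI allI impI)
  fix f and n :: nat assume "f \<in> vegetal_moulds" "1 \<le> n"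
  then show "rsubst_defined (\<lambda>_. inverse (fls_X :: rat fls)) (f n)"
    by (intro nice_homogeneous_defined [OF vegetal_mouldsD(1) admissible_const]) simp_all
next
  fix f assume f: "f \<in> vegetal_moulds"
  show "(\<lambda>n. at_x_inv (f (Suc n))) sums fps_to_fls (mould_to_vf f)"
    unfolding mould_to_vf_eq [OF f] by (rule at_x_inv_sums [OF f])
next
  have "pre_lie_morphism_axioms mould_scale vegetal_moulds mould_circ vf_scale UNIV vf_circ mould_to_vf"
  proof
    fix f g :: "nat \<Rightarrow> ratfun" and c assume f: "f \<in> vegetal_moulds"
    show "mould_to_vf f \<in> UNIV" by simp
    show "mould_to_vf (mould_scale c f) = vf_scale c (mould_to_vf f)"
      by (simp only: mould_to_vf_eq f vegetal_moulds_scale diagonal_series_scale)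
    assume g: "g \<in> vegetal_moulds"
    show "mould_to_vf (f + g) = mould_to_vf f + mould_to_vf g"
      by (simp only: mould_to_vf_eq f g vegetal_moulds_add diagonal_series_add)
    show "mould_to_vf (mould_circ f g) = vf_circ (mould_to_vf f) (mould_to_vf g)"
      by (simp only: mould_to_vf_eq f g vegetal_moulds_circ diagonal_series_mould_circ)
  qed
  then show "pre_lie_morphism mould_scale vegetal_moulds mould_circ vf_scale UNIV vf_circ mould_to_vf"
    by (rule pre_lie_morphism.intro [OF pre_lie_algebra_moulds pre_lie_algebra_vector_fields])
qed

end
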